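(* The set $\mathcal{C}(\partial D,\mathbb{C})\setminus\overline{\mathrm{Pol}(\partial D)}$ is (i) $(\alpha,\mathfrak{c})$-spaceable if and only if $\alpha<\aleph_0$; (ii) pointwise $\mathfrak{c}$-spaceable; (iii) $(\alpha,\beta)$-dense-lineable for every $\alpha<\mathfrak{c}$ and $\max\{\alpha,\aleph_0\}\leq\beta\leq\mathfrak{c}$; and (iv) pointwise maximal-dense-lineable.
   Context: $D=\{z\in\mathbb{C}:|z|<1\}$ and $\partial D$ is the unit circle. $\mathcal{C}(\partial D,\mathbb{C})$ is the Banach space of continuous functions $\partial D\to\mathbb{C}$ with the sup-norm. $\mathrm{Pol}(\partial D):=\{f|_{\partial D}:f\in\mathbb{C}[z]\}$ (complex polynomials in one variable restricted to $\partial D$), with norm closure $\overline{\mathrm{Pol}(\partial D)}$. $\mathfrak{c}$ is the cardinality of the continuum; all dimensions are algebraic dimensions. Let $V$ be a topological vector space, $M\subseteq V$, and $\alpha\leq\beta$ cardinals. $M$ is $\alpha$-lineable if $M\cup\{0\}$ contains a vector subspace of $V$ of dimension $\alpha$. $M$ is $(\alpha,\beta)$-spaceable if $M$ is $\alpha$-lineable and for each $\alpha$-dimensional vector subspace $V_\alpha$ of $V$ with $V_\alpha\subseteq M\cup\{0\}$ there is a closed $\beta$-dimensional subspace $V_\beta$ of $V$ with $V_\alpha\subseteq V_\beta\subseteq M\cup\{0\}$. $M$ is $(\alpha,\beta)$-dense-lineable if $M$ is $\alpha$-lineable and for each $\alpha$-dimensional vector subspace $V_\alpha$ of $V$ with $V_\alpha\subseteq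 M\cup\{0\}$ there is a dense $\beta$-dimensional subspace $V_\beta$ of $V$ with $V_\alpha\subseteq V_\beta\subseteq M\cup\{0\}$. $M$ is pointwise $\alpha$-spaceable (resp. pointwise $\alpha$-dense-lineable) if for every $x\in M$ there is a closed (resp. dense) $\alpha$-dimensional subspace $V_\alpha$ of $V$ with $x\in V_\alpha\subseteq M\cup\{0\}$. $M$ is pointwise maximal-dense-lineable if it is pointwise $\dim(V)$-dense-lineable. *)

theory Defs
  imports "HOL-Analysis.Analysis"
begin

unbundle cardinal_syntax

text \<open>
  Cardinal numbers are represented, as in the BNF cardinal library, by cardinal orders
  \<open>\<alpha> :: 'a rel\<close> with \<open>Card_order \<alpha>\<close>, compared across types by \<open>\<le>o\<close>, \<open><o\<close> and \<open>=o\<close>.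
\<close>

section \<open>Lineability in topological vector spaces\<close>

locale topological_vector_space = vector_space scale
  for scale :: "'k::real_normed_field \<Rightarrow> 'v::topological_ab_group_add \<Rightarrow> 'v" +
  assumes continuous_scale: "continuous_on UNIV (\<lambda>(c, x). scale c x)"
begin

text \<open>
  The library's \<open>dim\<close> is a natural number, equal to 0 for every infinite-dimensional space.
  This is the cardinal version; it does not depend on the chosen basis by \<open>card_dim_eq\<close> below.
\<close>

definition card_dim :: "'v set \<Rightarrow> 'v rel" where
  "card_dim W = |SOME B. independent B \<and> span B = span W|"

lemma card_of_basis_le:
  assumes B: "independent B" and C: "independent C" and eq: "span B = span C"
  shows "|B| \<le>o |C|"
proof (cases "finite C")
  case True
  then have fB: "finite B" and le: "card B \<le> card C"
    using independent_span_bound[OF True B] eq span_superset[of B] by auto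
  show ?thesis
    using card_le_inj[OF fB True le] by (auto simp: card_of_ordLeq[symmetric])
next
  case False
  have "\<exists>F. finite F \<and> F \<subseteq> B \<and> c \<in> span F" if "c \<in> C" for c
  proof -
    have "c \<in> span B" using that eq span_superset[of C] by auto
    then obtain t r where tr: "finite t" "t \<subseteq> B" "c = (\<Sum>a\<in>t. scale (r a) a)"
      unfolding span_explicit by auto
    have "c \<in> span t" unfolding tr(3) by (intro span_sum span_scale span_base)
    with tr show ?thesis by blast
  qed
  then obtain F where F: "\<And>c. c \<in> C \<Longrightarrow> finite (F c) \<and> F c \<subseteq> B \<and> c \<in> span (F c)"
    by metis
  define U where "U = (\<Union>c\<in>C. F c)"
  have UB: "U \<subseteq> B" using F by (auto simp: U_def)
  have "C \<subseteq> span U"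
  proof
    fix c assume "c \<in> C"
    then have "F c \<subseteq> U" by (auto simp: U_def)
    then show "c \<in> span U" using F[OF \<open>c \<in> C\<close>] span_mono by blast
  qed
  then have sp: "span B \<subseteq> span U"
    unfolding eq by (rule span_minimal[OF _ subspace_span])
  have "B \<subseteq> U"
  proof
    fix b assume b: "b \<in> B"
    show "b \<in> U"
    proof (rule ccontr)
      assume "b \<notin> U"
      then have "U \<subseteq> B - {b}" using UB by auto
      then have "b \<in> span (B - {b})" using sp b span_base span_mono by blast
      then show False using B b by (auto simp: dependent_def)
    qed
  qed
  have "|U| \<le>o |C|"
    unfolding U_def
  proof (rule card_of_UNION_ordLeq_infinite[OF False])
    show "\<forall>c\<in>C. |F c| \<le>o |C|"
      using F False by (metis card_of_ordLeq_infinite card_of_Well_order finite_iff_ordLess_natLeq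
          infinite_iff_natLeq_ordLeq ordLeq_transitive ordLess_imp_ordLeq)
  qed (simp add: card_of_mono1)
  moreover have "|B| \<le>o |U|" using \<open>B \<subseteq> U\<close> by (rule card_of_mono1)
  ultimately show ?thesis by (rule ordLeq_transitive[rotated])
qed

lemma card_dim_eq:
  assumes "independent B" "span B = span W"
  shows "card_dim W =o |B|"
proof -
  let ?C = "SOME B. independent B \<and> span B = span W"
  have C: "independent ?C \<and> span ?C = span W"
    by (rule someI[of "\<lambda>B. independent B \<and> span B = span W" B]) (use assms in auto)
  show ?thesis
    unfolding card_dim_def ordIso_iff_ordLeq
    using C assms by (auto intro!: card_of_basis_le)
qed

definition lineable :: "'a rel \<Rightarrow> 'v set \<Rightarrow> bool" where
  "lineable \<alpha> M \<longleftrightarrow> (\<exists>W. subspace W \<and> card_dim W =o \<alpha> \<and> W \<subseteq> M \<union> {0})"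

text \<open>
  The two-parameter notions are only meant for cardinals \<open>\<alpha> \<le>o \<beta>\<close>; this is a hypothesis where they
  are used, not part of the definitions.
\<close>

definition spaceable :: "'a rel \<Rightarrow> 'b rel \<Rightarrow> 'v set \<Rightarrow> bool" where
  "spaceable \<alpha> \<beta> M \<longleftrightarrow> lineable \<alpha> M \<and>
    (\<forall>W. subspace W \<and> card_dim W =o \<alpha> \<and> W \<subseteq> M \<union> {0} \<longrightarrow>
      (\<exists>W'. subspace W' \<and> closed W' \<and> card_dim W' =o \<beta> \<and> W \<subseteq> W' \<and> W' \<subseteq> M \<union> {0}))"

definition dense_lineable :: "'a rel \<Rightarrow> 'b rel \<Rightarrow> 'v set \<Rightarrow> bool" where
  "dense_lineable \<alpha> \<beta> M \<longleftrightarrow> lineable \<alpha> M \<and>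
    (\<forall>W. subspace W \<and> card_dim W =o \<alpha> \<and> W \<subseteq> M \<union> {0} \<longrightarrow>
      (\<exists>W'. subspace W' \<and> closure W' = UNIV \<and> card_dim W' =o \<beta> \<and> W \<subseteq> W' \<and> W' \<subseteq> M \<union> {0}))"

definition pointwise_spaceable :: "'a rel \<Rightarrow> 'v set \<Rightarrow> bool" where
  "pointwise_spaceable \<alpha> M \<longleftrightarrow>
    (\<forall>x\<in>M. \<exists>W. subspace W \<and> closed W \<and> card_dim W =o \<alpha> \<and> x \<in> W \<and> W \<subseteq> M \<union> {0})"

definition pointwise_dense_lineable :: "'a rel \<Rightarrow> 'v set \<Rightarrow> bool" where
  "pointwise_dense_lineable \<alpha> M \<longleftrightarrow>
    (\<forall>x\<in>M. \<exists>W. subspace W \<and> closure W = UNIV \<and> card_dim W =o \<alpha> \<and> x \<in> W \<and> W \<subseteq> M \<union> {0})"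

definition pointwise_maximal_dense_lineable :: "'v set \<Rightarrow> bool" where
  "pointwise_maximal_dense_lineable M \<longleftrightarrow> pointwise_dense_lineable (card_dim UNIV) M"

end

section \<open>Continuous functions on the unit circle\<close>

typedef unit_circle = "sphere (0::complex) 1"
  morphisms complex_of_circle circle_of_complex
  by (rule exI[of _ 1]) simp

setup_lifting type_definition_unit_circle

instantiation unit_circle :: metric_space
begin

lift_definition dist_unit_circle :: "unit_circle \<Rightarrow> unit_circle \<Rightarrow> real" is dist .

definition uniformity_unit_circle :: "(unit_circle \<times> unit_circle) filter" where
  "uniformity_unit_circle = (INF e\<in>{0<..}. principal {(x, y). dist x y < e})"

definition open_unit_circle :: "unit_circle set \<Rightarrow> bool" where
  "open_unit_circle U = (\<forall>x\<in>U. \<forall>\<^sub>F (x', y) in uniformity. x' = x \<longrightarrow> y \<in> U)"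

instance
proof
  fix x y z :: unit_circle
  show "dist x y = 0 \<longleftrightarrow> x = y" by transfer simp
  show "dist x y \<le> dist x z + dist y z" by transfer (rule dist_triangle2)
qed (simp_all only: uniformity_unit_circle_def open_unit_circle_def)

end

lemma continuous_on_complex_of_circle [continuous_intros]: "continuous_on S complex_of_circle"
  unfolding continuous_on_iff by (auto simp: dist_unit_circle.rep_eq)

lemma compact_UNIV_unit_circle: "compact (UNIV :: unit_circle set)"
proof -
  have "continuous_on (sphere 0 1) circle_of_complex"
    unfolding continuous_on_iff
    by (auto simp: dist_unit_circle.rep_eq circle_of_complex_inverse)
  then have "compact (circle_of_complex ` sphere 0 1)"
    by (rule compact_continuous_image) simp
  moreover have "circle_of_complex ` sphere 0 1 = UNIV"
    using type_definition.Abs_image[OF type_definition_unit_circle] .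
  ultimately show ?thesis by simp
qed

text \<open>
  The circle being compact, the bounded continuous functions \<open>unit_circle \<Rightarrow>\<^sub>C complex\<close> with the
  library's sup-norm are all the continuous functions.
\<close>

lemma bcontfun_unit_circle_iff:
  fixes f :: "unit_circle \<Rightarrow> complex"
  shows "f \<in> bcontfun \<longleftrightarrow> continuous_on UNIV f"
  using compact_continuous_image[OF _ compact_UNIV_unit_circle, of f]
  by (auto simp: bcontfun_def intro: compact_imp_bounded)

text \<open>The library only provides real scalar multiplication on \<open>\<Rightarrow>\<^sub>C\<close>.\<close>

definition scaleC_bcontfun ::
  "complex \<Rightarrow> ('a::topological_space \<Rightarrow>\<^sub>C complex) \<Rightarrow> ('a \<Rightarrow>\<^sub>C complex)" where
  "scaleC_bcontfun c f = Bcontfun (\<lambda>x. c * apply_bcontfun f x)"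

lemma apply_scaleC_bcontfun [simp]:
  "apply_bcontfun (scaleC_bcontfun c f) x = c * apply_bcontfun f x"
proof -
  have "bounded ((*) c ` range (apply_bcontfun f))"
    by (rule bounded_linear_image[OF bounded_apply_bcontfun bounded_linear_mult_right])
  then have "(\<lambda>x. c * apply_bcontfun f x) \<in> bcontfun"
    by (auto simp: bcontfun_def image_image intro!: continuous_intros)
  then show ?thesis
    by (simp add: scaleC_bcontfun_def Bcontfun_inverse)
qed

lemma norm_scaleC_bcontfun_le: "norm (scaleC_bcontfun c f) \<le> norm c * norm f"
  by (rule norm_bound)
    (auto simp: apply_scaleC_bcontfun norm_mult intro!: mult_left_mono norm_bounded)

interpretation bcontfun_C: topological_vector_space
  "scaleC_bcontfun :: complex \<Rightarrow> ('a::topological_space \<Rightarrow>\<^sub>C complex) \<Rightarrow> ('a \<Rightarrow>\<^sub>C complex)"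
proof
  show add_right: "scaleC_bcontfun c (f + g) = scaleC_bcontfun c f + scaleC_bcontfun c g"
    for c and f g :: "'a \<Rightarrow>\<^sub>C complex"
    by (rule bcontfun_eqI) (simp add: apply_scaleC_bcontfun plus_bcontfun.rep_eq algebra_simps)
  show add_left: "scaleC_bcontfun (c + d) f = scaleC_bcontfun c f + scaleC_bcontfun d f"
    for c d and f :: "'a \<Rightarrow>\<^sub>C complex"
    by (rule bcontfun_eqI) (simp add: apply_scaleC_bcontfun plus_bcontfun.rep_eq algebra_simps)
  show "scaleC_bcontfun c (scaleC_bcontfun d f) = scaleC_bcontfun (c * d) f"
    for c d and f :: "'a \<Rightarrow>\<^sub>C complex"
    by (rule bcontfun_eqI) (simp add: apply_scaleC_bcontfun)
  show "scaleC_bcontfun 1 f = f" for f :: "'a \<Rightarrow>\<^sub>C complex"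
    by (rule bcontfun_eqI) (simp add: apply_scaleC_bcontfun)
  have "bounded_bilinear (scaleC_bcontfun :: complex \<Rightarrow> ('a \<Rightarrow>\<^sub>C complex) \<Rightarrow> _)"
  proof
    show "scaleC_bcontfun (r *\<^sub>R c) f = r *\<^sub>R scaleC_bcontfun c f" for r c and f :: "'a \<Rightarrow>\<^sub>C complex"
      by (rule bcontfun_eqI) (simp add: apply_scaleC_bcontfun scaleR_bcontfun.rep_eq)
    show "scaleC_bcontfun c (r *\<^sub>R f) = r *\<^sub>R scaleC_bcontfun c f" for r c and f :: "'a \<Rightarrow>\<^sub>C complex"
      by (rule bcontfun_eqI) (simp add: apply_scaleC_bcontfun scaleR_bcontfun.rep_eq)
    show "\<exists>K. \<forall>c (f :: 'a \<Rightarrow>\<^sub>C complex). norm (scaleC_bcontfun c f) \<le> norm c * norm f * K"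
      by (rule exI[of _ 1]) (simp add: norm_scaleC_bcontfun_le)
  qed (fact add_left add_right)+
  then show "continuous_on UNIV (\<lambda>(c, f :: 'a \<Rightarrow>\<^sub>C complex). scaleC_bcontfun c f)"
    unfolding split_def
    by (rule bounded_bilinear.continuous_on) (auto intro!: continuous_intros)
qed

definition Pol_circle :: "(unit_circle \<Rightarrow>\<^sub>C complex) set" where
  "Pol_circle = {f. \<exists>p :: complex poly. \<forall>z. apply_bcontfun f z = poly p (complex_of_circle z)}"

end

theory Submission
  imports Defs
begin

text \<open>
  Let \<open>A\<close> be the closure of the polynomials in the space \<open>E\<close> of continuous functions on the circle.
  Two facts about \<open>A\<close> are used: it is a subspace containing the constants, and its
  elements have no negative Fourier coefficients. Density of the trigonometric polynomials shows that
  a continuous function is determined by its Fourier coefficients. So \<open>E\<close> has the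
  cardinality of the continuum, and the closed space of functions with only negative frequencies meets
  \<open>A\<close> in \<open>0\<close>. It contains the functions \<open>h t = \<Sum>k>0. (t/z)^k\<close> for \<open>0 < t < 1\<close>, which are linearly
  independent modulo \<open>A\<close> by a Vandermonde argument. A subspace is admissible if it meets \<open>A\<close> only in \<open>0\<close>.

  A finite-dimensional admissible space \<open>W\<close> has an admissible closed extension: for \<open>m\<close> large enough,
  the space of functions whose frequencies are all below \<open>- m\<close> is in direct sum with \<open>A + W\<close>
  (\<open>frequencies_below_avoid_finite_dimensional\<close>), and adding the finite-dimensional \<open>W\<close> to it keeps it
  closed. For an infinite cardinal this fails: the functions \<open>1 + h t\<close> span admissible spaces of every
  infinite dimension up to the continuum, and \<open>1 + h t \<rightarrow> 1 \<in> A\<close> as \<open>t \<rightarrow> 0\<close>, so if the parameters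
  \<open>t\<close> accumulate at \<open>0\<close> then no closed extension is admissible
  (\<open>ex_span_accumulating_at_closure_Pol_circle\<close>).

  For dense extensions, let \<open>W\<close> be admissible of dimension less than the continuum. Continuum many of the
  \<open>h t\<close> remain independent modulo the space spanned by \<open>A\<close>, \<open>W\<close> and all powers of \<open>z\<close>
  (\<open>large_independent_modulo\<close>). Replacing countably many of them by \<open>z^k + h t / (n + 1)\<close> for all
  integers \<open>k\<close> and naturals \<open>n\<close> does not affect independence, but makes the span
  dense (\<open>ex_dense_extension_avoiding_closure_Pol_circle\<close>). The pointwise statements are the case of a
  one-dimensional \<open>W\<close>.
\<close>

section \<open>Families that are linearly independent modulo a subspace\<close>

context topological_vector_space begin

text \<open>
  Linear independence of the images of the \<open>g i\<close> in the quotient by \<open>Y\<close>. Being stated for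
  indexed families, it forces \<open>g\<close> to be injective, so that an independent family has as many
  members as its index set.
\<close>

definition independent_modulo :: "'v set \<Rightarrow> ('i \<Rightarrow> 'v) \<Rightarrow> 'i set \<Rightarrow> bool" where
  "independent_modulo Y g I \<longleftrightarrow>
    (\<forall>F c. finite F \<and> F \<subseteq> I \<and> (\<Sum>i\<in>F. scale (c i) (g i)) \<in> Y \<longrightarrow> (\<forall>i\<in>F. c i = 0))"

lemma independent_moduloD:
  "independent_modulo Y g I \<Longrightarrow> finite F \<Longrightarrow> F \<subseteq> I \<Longrightarrow> (\<Sum>i\<in>F. scale (c i) (g i)) \<in> Y \<Longrightarrow> i \<in> F \<Longrightarrow> c i = 0"
  unfolding independent_modulo_def by blast

lemma independent_modulo_mono:
  "independent_modulo Y g I \<Longrightarrow> Z \<subseteq> Y \<Longrightarrow> J \<subseteq> I \<Longrightarrow> independent_modulo Z g J"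
  unfolding independent_modulo_def by (meson subset_trans subsetD)

lemma independent_modulo_reindex:
  assumes g: "independent_modulo Y g I" and \<sigma>: "inj_on \<sigma> J" "\<sigma> ` J \<subseteq> I"
  shows "independent_modulo Y (g \<circ> \<sigma>) J"
  unfolding independent_modulo_def
proof (intro allI impI ballI, elim conjE)
  fix F c i assume F: "finite F" "F \<subseteq> J" "(\<Sum>j\<in>F. scale (c j) ((g \<circ> \<sigma>) j)) \<in> Y" "i \<in> F"
  have inj: "inj_on \<sigma> F" using \<sigma>(1) F(2) by (rule inj_on_subset)
  have "(\<Sum>k\<in>\<sigma> ` F. scale (c (the_inv_into F \<sigma> k)) (g k)) = (\<Sum>j\<in>F. scale (c j) ((g \<circ> \<sigma>) j))"
    by (simp add: sum.reindex[OF inj] the_inv_into_f_f[OF inj])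
  then have "c (the_inv_into F \<sigma> (\<sigma> i)) = 0"
    using independent_moduloD[OF g, of "\<sigma> ` F" "\<lambda>k. c (the_inv_into F \<sigma> k)" "\<sigma> i"] F \<sigma> by auto
  then show "c i = 0" by (simp add: the_inv_into_f_f[OF inj F(4)])
qed

text \<open>
  In the quotient by \<open>Y\<close>, each \<open>x i\<close> is a nonzero multiple of \<open>g i\<close>. This makes it possible to move
  the members of a family close to prescribed vectors of \<open>Y\<close> without losing independence.
\<close>

lemma independent_modulo_perturb:
  assumes Y: "subspace Y" and g: "independent_modulo Y g I"
    and x: "\<And>i. i \<in> I \<Longrightarrow> e i \<noteq> 0 \<and> x i - scale (e i) (g i) \<in> Y"
  shows "independent_modulo Y x I"
  unfolding independent_modulo_def
proof (intro allI impI ballI, elim conjE)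
  fix F c i assume F: "finite F" "F \<subseteq> I" "(\<Sum>j\<in>F. scale (c j) (x j)) \<in> Y" "i \<in> F"
  have "(\<Sum>j\<in>F. scale (c j) (x j - scale (e j) (g j))) \<in> Y"
    using F x by (intro subspace_sum[OF Y] subspace_scale[OF Y]) auto
  from subspace_diff[OF Y F(3) this] have "(\<Sum>j\<in>F. scale (c j * e j) (g j)) \<in> Y"
    by (simp add: scale_right_diff_distrib sum_subtractf)
  from independent_moduloD[OF g F(1,2) this F(4)] show "c i = 0" using x F by auto
qed

lemma independent_modulo_inj:
  assumes Y: "subspace Y" and g: "independent_modulo Y g I"
  shows "inj_on g I"
proof (rule inj_onI, rule ccontr)
  fix i j assume ij: "i \<in> I" "j \<in> I" "g i = g j" "i \<noteq> j"
  then have "(\<Sum>k\<in>{i, j}. scale (if k = i then 1 else - 1) (g k)) \<in> Y"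
    using subspace_0[OF Y] by (simp add: scale_minus_left)
  from independent_moduloD[OF g _ _ this, of i] ij show False by simp
qed

lemma independent_modulo_sum_image:
  assumes Y: "subspace Y" and g: "independent_modulo Y g I"
    and t: "finite t" "t \<subseteq> g ` I" "(\<Sum>v\<in>t. scale (u v) v) \<in> Y" "v \<in> t"
  shows "u v = 0"
proof -
  obtain F where F: "F \<subseteq> I" "t = g ` F" "finite F" using finite_subset_image t(1,2) by metis
  have inj: "inj_on g F" using independent_modulo_inj[OF Y g] F(1) by (rule inj_on_subset)
  obtain i where i: "i \<in> F" "v = g i" using t(4) F by auto
  show ?thesis
    using independent_moduloD[OF g F(3,1), of "u \<circ> g" i] t(3) i by (simp add: F(2) sum.reindex[OF inj])
qed

lemma independent_modulo_span_Int:
  assumes Y: "subspace Y" and g: "independent_modulo Y g I" and v: "v \<in> span (g ` I)" "v \<in> Y"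
  shows "v = 0"
proof -
  obtain t r where t: "finite t" "t \<subseteq> g ` I" "v = (\<Sum>a\<in>t. scale (r a) a)"
    using v(1) unfolding span_explicit by auto
  have "\<forall>a\<in>t. r a = 0"
    using independent_modulo_sum_image[OF Y g t(1,2), of r] v(2) t(3) by simp
  then show ?thesis unfolding t(3) by (simp add: sum.neutral)
qed

text \<open>
  A vanishing combination of \<open>B \<union> g ` I\<close> puts its \<open>g\<close>-part into \<open>Y\<close>, so the \<open>g\<close>-coefficients vanish
  first and the remaining ones vanish by independence of \<open>B\<close>.
\<close>

lemma independent_modulo_union_basis:
  assumes Y: "subspace Y" and g: "independent_modulo Y g I" and B: "independent B" "B \<subseteq> Y"
  shows "independent (B \<union> g ` I)"
  unfolding independent_explicit_module
proof (intro allI impI)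
  fix t u v assume t: "finite t" "t \<subseteq> B \<union> g ` I" "(\<Sum>v\<in>t. scale (u v) v) = 0" "v \<in> t"
  have split: "(\<Sum>v\<in>t. scale (u v) v) = (\<Sum>v\<in>t \<inter> B. scale (u v) v) + (\<Sum>v\<in>t - B. scale (u v) v)"
    using sum.Int_Diff[OF t(1)] .
  have "(\<Sum>v\<in>t \<inter> B. scale (u v) v) \<in> Y"
    using B(2) by (intro subspace_sum[OF Y] subspace_scale[OF Y]) auto
  then have "(\<Sum>v\<in>t - B. scale (u v) v) \<in> Y"
    using t(3) split subspace_neg[OF Y] by (metis add_eq_0_iff)
  then have z: "u v = 0" if "v \<in> t - B" for v
    using independent_modulo_sum_image[OF Y g, of "t - B" u v] t(1,2) that by auto
  then have "(\<Sum>v\<in>t \<inter> B. scale (u v) v) = 0"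
    using split t(3) by (simp add: sum.neutral)
  then have "u v = 0" if "v \<in> t \<inter> B"
    using independentD[OF B(1), of "t \<inter> B" u v] t(1) that by auto
  with z t(4) show "u v = 0" by blast
qed

lemma independent_modulo_span:
  assumes "independent D" "P \<subseteq> D" "inj_on g J" "g ` J \<subseteq> D - P"
  shows "independent_modulo (span P) g J"
  unfolding independent_modulo_def
proof (intro allI impI ballI, elim conjE, rule ccontr)
  fix F c i assume F: "finite F" "F \<subseteq> J" "(\<Sum>j\<in>F. scale (c j) (g j)) \<in> span P" "i \<in> F" "c i \<noteq> 0"
  let ?S = "span (D - {g i})"
  have "P \<subseteq> D - {g i}" using assms(2,4) F(2,4) by auto
  then have "span P \<subseteq> ?S" by (rule span_mono)
  then have 1: "(\<Sum>j\<in>F. scale (c j) (g j)) \<in> ?S" using F(3) by auto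
  have 2: "(\<Sum>j\<in>F - {i}. scale (c j) (g j)) \<in> ?S"
  proof (intro span_sum span_scale span_base)
    fix j assume j: "j \<in> F - {i}"
    then have "g j \<noteq> g i" using assms(3) F(2,4) by (auto dest: inj_onD)
    then show "g j \<in> D - {g i}" using assms(4) F(2) j by auto
  qed
  have "scale (c i) (g i) \<in> ?S"
    using span_diff[OF 1 2] by (simp add: sum.remove[OF F(1,4)])
  from span_scale[OF this, of "inverse (c i)"] have "g i \<in> ?S" using F(5) by simp
  then show False using assms(1,4) F(2,4) unfolding dependent_def by blast
qed

text \<open>
  Extend a basis of \<open>A\<close> together with the whole family \<open>g\<close> to a basis \<open>D\<close> of the space. Every vector
  of \<open>C\<close> involves finitely many elements of \<open>D\<close>, so \<open>C\<close> lies in the span of at most \<open>|C|\<close> basis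
  vectors; since \<open>|C| <o |I|\<close>, discarding the members of \<open>g\<close> among them leaves \<open>|I|\<close> many, which stay
  independent modulo the span \<open>Y\<close> of \<open>A\<close> and the discarded basis vectors.
\<close>

lemma large_independent_modulo:
  fixes g :: "'i \<Rightarrow> 'v"
  assumes A: "subspace A" and g: "independent_modulo A g I"
    and C: "infinite C" "|C| <o |I|"
  obtains Y J where "subspace Y" "A \<subseteq> Y" "C \<subseteq> Y" "J \<subseteq> I" "|I| \<le>o |J|" "independent_modulo Y g J"
proof -
  obtain BA where BA: "BA \<subseteq> A" "independent BA" "A \<subseteq> span BA"
    using maximal_independent_subset by blast
  have ind: "independent (BA \<union> g ` I)"
    by (rule independent_modulo_union_basis[OF A g BA(2,1)])
  obtain D where D: "BA \<union> g ` I \<subseteq> D" "independent D" "UNIV \<subseteq> span D"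
    using maximal_independent_subset_extend[OF subset_UNIV ind] by metis
  have "\<exists>F. finite F \<and> F \<subseteq> D \<and> c \<in> span F" for c
  proof -
    have "c \<in> span D" using D(3) by auto
    then obtain t r where tr: "finite t" "t \<subseteq> D" "c = (\<Sum>a\<in>t. scale (r a) a)"
      unfolding span_explicit by auto
    have "c \<in> span t" unfolding tr(3) by (intro span_sum span_scale span_base)
    with tr show ?thesis by blast
  qed
  then obtain F where F: "\<And>c. finite (F c) \<and> F c \<subseteq> D \<and> c \<in> span (F c)"
    by metis
  define U where "U = (\<Union>c\<in>C. F c)"
  define Y where "Y = span (BA \<union> U)"
  define J where "J = {i\<in>I. g i \<notin> BA \<union> U}"
  have "inj_on g I" by (rule independent_modulo_inj[OF A g])
  have "C \<subseteq> Y"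
  proof
    fix c assume "c \<in> C"
    then have "F c \<subseteq> BA \<union> U" by (auto simp: U_def)
    then show "c \<in> Y" using F[of c] span_mono unfolding Y_def by blast
  qed
  moreover have "A \<subseteq> Y" using BA(3) span_mono[of BA "BA \<union> U"] by (auto simp: Y_def)
  moreover have "independent_modulo Y g J"
    unfolding Y_def
  proof (rule independent_modulo_span[OF D(2)])
    show "BA \<union> U \<subseteq> D" using D(1) F by (auto simp: U_def)
    show "inj_on g J" using \<open>inj_on g I\<close> by (auto simp: J_def intro: inj_on_subset)
    show "g ` J \<subseteq> D - (BA \<union> U)" using D(1) by (auto simp: J_def)
  qed
  moreover have "|I| \<le>o |J|"
  proof (rule ccontr)
    assume "\<not> |I| \<le>o |J|"
    then have J: "|J| <o |I|" by (simp add: card_of_Well_order not_ordLeq_iff_ordLess)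
    have "|U| \<le>o |C|"
      unfolding U_def
    proof (rule card_of_UNION_ordLeq_infinite[OF C(1)])
      show "\<forall>c\<in>C. |F c| \<le>o |C|"
        using F C(1) by (metis card_of_ordLeq_infinite card_of_Well_order finite_iff_ordLess_natLeq
            infinite_iff_natLeq_ordLeq ordLeq_transitive ordLess_imp_ordLeq)
    qed (simp add: card_of_mono1)
    then have U: "|U| <o |I|" using C(2) by (rule ordLeq_ordLess_trans)
    have "|{i\<in>I. g i \<in> U}| \<le>o |U|"
      using \<open>inj_on g I\<close> by (intro card_of_ordLeqI[of g]) (auto intro: inj_on_subset)
    then have I2: "|{i\<in>I. g i \<in> U}| <o |I|" using U by (rule ordLeq_ordLess_trans)
    have "g i \<notin> BA" if "i \<in> I" for i
      using independent_moduloD[OF g, of "{i}" "\<lambda>_. 1" i] BA(1) that by auto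
    then have I: "I = J \<union> {i\<in>I. g i \<in> U}" by (auto simp: J_def)
    have "infinite I"
      using C ordLess_imp_ordLeq card_of_ordLeq_infinite by metis
    from card_of_Un_ordLess_infinite[OF this J I2] I show False
      by (metis ordLess_irreflexive)
  qed
  ultimately show thesis
    by (intro that[of Y J]) (auto simp: Y_def J_def)
qed

lemma card_of_image_independent_modulo:
  assumes "subspace Y" "independent_modulo Y g I"
  shows "|g ` I| =o |I|"
  using inj_on_imp_bij_betw[OF independent_modulo_inj[OF assms]]
  by (intro ordIso_symmetric[OF card_of_ordIsoI])

lemma card_dim_span_independent_modulo:
  assumes Y: "subspace Y" "independent_modulo Y g I"
  shows "card_dim (span (g ` I)) =o |I|"
proof -
  have "independent (g ` I)"
    using independent_modulo_union_basis[OF Y, of "{}"] by (simp add: independent_empty)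
  then have "card_dim (span (g ` I)) =o |g ` I|" by (rule card_dim_eq) (simp add: span_span)
  then show ?thesis
    using card_of_image_independent_modulo[OF Y] by (rule ordIso_transitive)
qed

lemma subspace_closure:
  assumes S: "subspace S"
  shows "subspace (closure S)"
proof (rule subspaceI)
  show "0 \<in> closure S" using subspace_0[OF S] closure_subset by blast
next
  fix x y assume xy: "x \<in> closure S" "y \<in> closure S"
  have "(\<lambda>p. fst p + snd p) ` closure (S \<times> S) \<subseteq> closure S"
    using subspace_add[OF S] closure_subset[of S]
    by (intro image_closure_subset continuous_intros) auto
  with xy show "x + y \<in> closure S" by (force simp: closure_Times)
next
  fix c x assume x: "x \<in> closure S"
  have "continuous_on UNIV ((\<lambda>(c, x). scale c x) \<circ> (\<lambda>x. (c, x)))"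
    by (rule continuous_on_compose)
      (auto intro!: continuous_intros continuous_on_subset[OF continuous_scale])
  then have "continuous_on (closure S) (\<lambda>x. scale c x)"
    by (auto simp: o_def intro: continuous_on_subset)
  then have "(\<lambda>x. scale c x) ` closure S \<subseteq> closure S"
    using subspace_scale[OF S] closure_subset[of S] by (intro image_closure_subset) auto
  with x show "scale c x \<in> closure S" by blast
qed

lemma card_dim_basis:
  assumes "subspace W"
  obtains B where "independent B" "span B = W" "card_dim W =o |B|"
proof -
  obtain B where B: "B \<subseteq> W" "independent B" "W \<subseteq> span B"
    using maximal_independent_subset by blast
  then have eq: "span B = W" using span_minimal[OF B(1) assms] by auto
  then have "span B = span W" by (metis span_span)
  then show thesis using that B(2) eq card_dim_eq by blast
qed

end

section \<open>Trigonometric polynomials are dense\<close>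

type_synonym circle_fun = "unit_circle \<Rightarrow>\<^sub>C complex"

instance bcontfun :: (metric_space, banach) banach ..

definition circle_power :: "int \<Rightarrow> circle_fun" where
  "circle_power n = Bcontfun (\<lambda>z. complex_of_circle z powi n)"

lemma norm_complex_of_circle [simp]: "norm (complex_of_circle z) = 1"
  using complex_of_circle[of z] by simp

lemma complex_of_circle_nonzero [simp]: "complex_of_circle z \<noteq> 0"
  using norm_complex_of_circle[of z] by (metis norm_zero zero_neq_one)

lemma apply_circle_power [simp]: "apply_bcontfun (circle_power n) z = complex_of_circle z powi n"
proof -
  have "continuous_on UNIV (\<lambda>z. complex_of_circle z powi n)"
    by (intro continuous_intros) auto
  then show ?thesis
    unfolding circle_power_def
    by (simp add: Bcontfun_inverse bcontfun_unit_circle_iff)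
qed

lemma norm_circle_power_le: "norm (circle_power n) \<le> 1"
  by (rule norm_bound) (simp add: norm_power_int)

text \<open>
  By bilinearity this reduces to \<open>z^m * z^n = z^(m+n)\<close>.
\<close>

lemma circle_power_span_closed_under_mult:
  assumes "f \<in> bcontfun_C.span (range circle_power)" "g \<in> bcontfun_C.span (range circle_power)"
  shows "\<exists>h \<in> bcontfun_C.span (range circle_power).
    \<forall>z. apply_bcontfun h z = apply_bcontfun f z * apply_bcontfun g z"
proof -
  let ?T = "bcontfun_C.span (range circle_power)"
  have one: "\<exists>h\<in>?T. \<forall>z. apply_bcontfun h z = apply_bcontfun (circle_power m) z * apply_bcontfun g z"
    if "g \<in> ?T" for m g
    using that
  proof (induction rule: bcontfun_C.span_induct_alt)
    case base
    show ?case by (intro bexI[of _ 0] bcontfun_C.span_zero) simp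
  next
    case (step c x y)
    then obtain n h where h: "x = circle_power n" "h \<in> ?T"
      "\<forall>z. apply_bcontfun h z = apply_bcontfun (circle_power m) z * apply_bcontfun y z" by auto
    show ?case
    proof (intro bexI[of _ "scaleC_bcontfun c (circle_power (m + n)) + h"] allI)
      show "scaleC_bcontfun c (circle_power (m + n)) + h \<in> ?T"
        by (intro bcontfun_C.span_add bcontfun_C.span_scale h(2)) (auto intro: bcontfun_C.span_base)
    qed (simp add: h power_int_add algebra_simps)
  qed
  show ?thesis
    using assms(1)
  proof (induction rule: bcontfun_C.span_induct_alt)
    case base
    show ?case by (intro bexI[of _ 0] bcontfun_C.span_zero) simp
  next
    case (step c x y)
    then obtain m h where h: "x = circle_power m" "h \<in> ?T"
      "\<forall>z. apply_bcontfun h z = apply_bcontfun y z * apply_bcontfun g z" by auto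
    obtain k where k: "k \<in> ?T" "\<forall>z. apply_bcontfun k z = apply_bcontfun x z * apply_bcontfun g z"
      using one[OF assms(2)] h(1) by metis
    show ?case
    proof (intro bexI[of _ "scaleC_bcontfun c k + h"] allI)
      show "scaleC_bcontfun c k + h \<in> ?T"
        by (intro bcontfun_C.span_add bcontfun_C.span_scale h(2) k(1))
    qed (simp add: h k algebra_simps)
  qed
qed

text \<open>
  On the circle \<open>cnj z = inverse z\<close>, so the real and imaginary parts of \<open>z\<close> are combinations of
  \<open>z\<close> and \<open>inverse z\<close>, and every real polynomial in them is a trigonometric polynomial.
\<close>

lemma real_polynomial_on_circle:
  fixes p :: "complex \<Rightarrow> real"
  assumes "real_polynomial_function p"
  shows "\<exists>h \<in> bcontfun_C.span (range circle_power).
    \<forall>z. apply_bcontfun h z = complex_of_real (p (complex_of_circle z))"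
  using assms
proof (induction rule: real_polynomial_function.induct)
  case (linear f)
  let ?h = "scaleC_bcontfun (Complex (f 1) (- f \<i>) / 2) (circle_power 1) +
    scaleC_bcontfun (Complex (f 1) (f \<i>) / 2) (circle_power (- 1))"
  show ?case
  proof (intro bexI[of _ ?h] allI)
    fix z
    define w where "w = complex_of_circle z"
    interpret f: bounded_linear f by (fact linear)
    have "w * cnj w = 1" using complex_norm_square[of w] by (simp add: w_def)
    then have inv: "inverse w = cnj w" by (rule inverse_unique)
    have "f w = f (Re w *\<^sub>R 1 + Im w *\<^sub>R \<i>)"
      by (rule arg_cong[of _ _ f]) (simp add: complex_eq_iff)
    also have "\<dots> = Re w * f 1 + Im w * f \<i>"
      by (simp only: f.add f.scaleR real_scaleR_def)
    finally have fw: "f w = Re w * f 1 + Im w * f \<i>" .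
    have "apply_bcontfun ?h z = Complex (f 1) (- f \<i>) / 2 * w + Complex (f 1) (f \<i>) / 2 * cnj w"
      by (simp add: w_def[symmetric] power_int_minus inv)
    also have "\<dots> = complex_of_real (f w)"
      unfolding fw by (simp add: complex_eq_iff field_simps)
    finally show "apply_bcontfun ?h z = complex_of_real (f (complex_of_circle z))"
      by (simp add: w_def)
  qed (intro bcontfun_C.span_add bcontfun_C.span_scale bcontfun_C.span_base, auto)
next
  case (const c)
  show ?case
    by (intro bexI[of _ "scaleC_bcontfun (of_real c) (circle_power 0)"]
        bcontfun_C.span_scale bcontfun_C.span_base) auto
next
  case (add f g)
  then obtain h k where "h \<in> bcontfun_C.span (range circle_power)" "k \<in> bcontfun_C.span (range circle_power)"
    "\<forall>z. apply_bcontfun h z = complex_of_real (f (complex_of_circle z))"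
    "\<forall>z. apply_bcontfun k z = complex_of_real (g (complex_of_circle z))" by auto
  then show ?case
    by (intro bexI[of _ "h + k"] bcontfun_C.span_add) auto
next
  case (mult f g)
  then obtain h k where hk: "h \<in> bcontfun_C.span (range circle_power)" "k \<in> bcontfun_C.span (range circle_power)"
    "\<forall>z. apply_bcontfun h z = complex_of_real (f (complex_of_circle z))"
    "\<forall>z. apply_bcontfun k z = complex_of_real (g (complex_of_circle z))" by auto
  show ?case
    using circle_power_span_closed_under_mult[OF hk(1,2)] hk(3,4) by auto
qed

text \<open>
  Stone--Weierstrass on the circle as a compact subset of the plane, applied to polynomials in the real and
  imaginary parts of \<open>z\<close>.
\<close>

lemma closure_trigonometric_polynomials:
  "closure (bcontfun_C.span (range circle_power)) = UNIV"
proof -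
  let ?T = "bcontfun_C.span (range circle_power)"
  have "\<exists>h\<in>?T. dist h f < e" if e: "e > 0" for f and e :: real
  proof -
    have "continuous_on (sphere 0 1) circle_of_complex"
      unfolding continuous_on_iff
      by (auto simp: dist_unit_circle.rep_eq circle_of_complex_inverse)
    then have "continuous_on (sphere 0 1) (apply_bcontfun f \<circ> circle_of_complex)"
      by (intro continuous_on_compose) auto
    then obtain g where g: "polynomial_function g"
      "\<forall>x\<in>sphere 0 1. norm ((apply_bcontfun f \<circ> circle_of_complex) x - g x) < e / 2"
      using Stone_Weierstrass_polynomial_function[of "sphere 0 1" "apply_bcontfun f \<circ> circle_of_complex" "e / 2"]
        e by auto
    have reim: "real_polynomial_function (Re \<circ> g)" "real_polynomial_function (Im \<circ> g)"
      using g(1) bounded_linear_Re bounded_linear_Im unfolding polynomial_function_def by blast+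
    then obtain h k where hk: "h \<in> ?T" "k \<in> ?T"
      "\<And>z. apply_bcontfun h z = complex_of_real (Re (g (complex_of_circle z)))"
      "\<And>z. apply_bcontfun k z = complex_of_real (Im (g (complex_of_circle z)))"
      using real_polynomial_on_circle[OF reim(1)] real_polynomial_on_circle[OF reim(2)] by auto
    let ?p = "h + scaleC_bcontfun \<i> k"
    have p: "apply_bcontfun ?p z = g (complex_of_circle z)" for z
      by (simp add: hk complex_eq_iff)
    have "norm (?p - f) \<le> e / 2"
    proof (rule norm_bound)
      fix z
      have "norm (apply_bcontfun f z - g (complex_of_circle z)) < e / 2"
        using g(2)[rule_format, of "complex_of_circle z"] by (simp add: complex_of_circle_inverse)
      then show "norm (apply_bcontfun (?p - f) z) \<le> e / 2"
        using p[of z] by (simp add: norm_minus_commute)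
    qed
    then have "dist ?p f < e" using e by (simp add: dist_norm)
    moreover have "?p \<in> ?T" by (intro bcontfun_C.span_add bcontfun_C.span_scale hk(1,2))
    ultimately show ?thesis by blast
  qed
  then show ?thesis by (auto simp: closure_approachable)
qed

section \<open>The mean over the circle and Fourier coefficients\<close>

definition circle_mean :: "(unit_circle \<Rightarrow> complex) \<Rightarrow> complex" where
  "circle_mean f = integral {0..2 * pi} (\<lambda>\<theta>. f (circle_of_complex (cis \<theta>))) / (2 * pi)"

lemma continuous_on_circle_of_complex_cis:
  assumes "continuous_on UNIV f"
  shows "continuous_on S (\<lambda>\<theta>. f (circle_of_complex (cis \<theta>)))"
proof -
  have "continuous_on S (\<lambda>\<theta>. circle_of_complex (cis \<theta>))"
    using continuous_on_cis[OF continuous_on_id]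
    unfolding continuous_on_iff
    by (auto simp: dist_unit_circle.rep_eq circle_of_complex_inverse)
  from continuous_on_compose2[OF assms this] show ?thesis by simp
qed

lemma circle_mean_integrable:
  fixes f :: "unit_circle \<Rightarrow> complex"
  assumes "continuous_on UNIV f"
  shows "(\<lambda>\<theta>. f (circle_of_complex (cis \<theta>))) integrable_on {0..2 * pi}"
  by (rule integrable_continuous_real) (rule continuous_on_circle_of_complex_cis[OF assms])

lemma circle_mean_add:
  "continuous_on UNIV f \<Longrightarrow> continuous_on UNIV g \<Longrightarrow>
    circle_mean (\<lambda>z. f z + g z) = circle_mean f + circle_mean g"
  unfolding circle_mean_def
  by (simp add: integral_add circle_mean_integrable add_divide_distrib)

lemma circle_mean_mult: "circle_mean (\<lambda>z. c * f z) = c * circle_mean f"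
  unfolding circle_mean_def by simp

lemma norm_circle_mean_le:
  assumes f: "continuous_on UNIV f" "\<And>z. norm (f z) \<le> b"
  shows "norm (circle_mean f) \<le> b"
proof -
  have "norm (integral {0..2 * pi} (\<lambda>\<theta>. f (circle_of_complex (cis \<theta>)))) \<le> b * (2 * pi - 0)"
    using f by (intro integral_bound continuous_on_circle_of_complex_cis) auto
  then show ?thesis
    by (simp add: circle_mean_def norm_divide divide_simps)
qed

lemma circle_mean_power:
  "circle_mean (\<lambda>z. complex_of_circle z powi n) = (if n = 0 then 1 else 0)"
proof (cases "n = 0")
  case True
  then show ?thesis by (simp add: circle_mean_def scaleR_conv_of_real)
next
  case False
  have eq: "complex_of_circle (circle_of_complex (cis \<theta>)) powi n = cis (of_int n * \<theta>)" for \<theta>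
    by (simp add: circle_of_complex_inverse cis_power_int)
  have "((\<lambda>\<theta>. cis (of_int n * \<theta>)) has_integral
      cis (of_int n * (2 * pi)) / (\<i> * of_int n) - cis (of_int n * 0) / (\<i> * of_int n)) {0..2 * pi}"
  proof (rule fundamental_theorem_of_calculus)
    fix \<theta> :: real
    have "((\<lambda>w. exp (\<i> * (of_int n * w)) / (\<i> * of_int n)) has_field_derivative
        exp (\<i> * (of_int n * of_real \<theta>))) (at (of_real \<theta>))"
      using False by (auto intro!: derivative_eq_intros simp: mult_ac)
    from has_vector_derivative_real_field[OF this]
    show "((\<lambda>x. cis (of_int n * x) / (\<i> * of_int n)) has_vector_derivative
        cis (of_int n * \<theta>)) (at \<theta> within {0..2 * pi})"
      by (simp add: cis_conv_exp)
  qed simp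
  moreover have "cis (of_int n * (2 * pi)) = 1"
    using cis_multiple_2pi[of "of_int n"] by (simp add: mult_ac)
  ultimately have "integral {0..2 * pi} (\<lambda>\<theta>. cis (of_int n * \<theta>)) = 0"
    by (simp add: integral_unique)
  then show ?thesis using False by (simp add: circle_mean_def eq)
qed

definition fourier_coeff :: "int \<Rightarrow> circle_fun \<Rightarrow> complex" where
  "fourier_coeff n f = circle_mean (\<lambda>z. complex_of_circle z powi (- n) * apply_bcontfun f z)"

lemma mean_against_bounded_linear:
  fixes g :: "unit_circle \<Rightarrow> complex"
  assumes g: "continuous_on UNIV g"
  shows "bounded_linear (\<lambda>f :: circle_fun. circle_mean (\<lambda>z. g z * apply_bcontfun f z))"
proof -
  obtain b where b: "\<And>z. norm (g z) \<le> b"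
    using compact_imp_bounded[OF compact_continuous_image[OF g compact_UNIV_unit_circle]]
    by (auto simp: bounded_iff)
  show ?thesis
  proof (rule bounded_linear_intro[where K = b])
    show "circle_mean (\<lambda>z. g z * apply_bcontfun (f + h) z) =
        circle_mean (\<lambda>z. g z * apply_bcontfun f z) + circle_mean (\<lambda>z. g z * apply_bcontfun h z)"
      for f h
      by (subst circle_mean_add[symmetric]) (auto intro!: continuous_intros g simp: distrib_left)
    show "circle_mean (\<lambda>z. g z * apply_bcontfun (r *\<^sub>R f) z) =
        r *\<^sub>R circle_mean (\<lambda>z. g z * apply_bcontfun f z)" for r and f :: circle_fun
      using circle_mean_mult[of "of_real r" "\<lambda>z. g z * apply_bcontfun f z"]
      by (simp add: scaleR_conv_of_real mult_ac)
    show "norm (circle_mean (\<lambda>z. g z * apply_bcontfun f z)) \<le> norm f * b" for f :: circle_fun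
      by (rule norm_circle_mean_le)
        (auto intro!: continuous_intros g simp: norm_mult mult.commute[of "norm f"]
          intro!: mult_mono b norm_bounded order_trans[OF norm_ge_zero b])
  qed
qed

lemma bounded_linear_fourier_coeff: "bounded_linear (fourier_coeff n)"
  unfolding fourier_coeff_def[abs_def]
  by (rule mean_against_bounded_linear) (intro continuous_intros, auto)

lemma fourier_coeff_scale: "fourier_coeff n (scaleC_bcontfun c f) = c * fourier_coeff n f"
  unfolding fourier_coeff_def
  by (subst circle_mean_mult[symmetric]) (simp add: mult_ac)

lemmas fourier_coeff_add = linear_add[OF bounded_linear.linear[OF bounded_linear_fourier_coeff]]
lemmas fourier_coeff_diff = linear_diff[OF bounded_linear.linear[OF bounded_linear_fourier_coeff]]
lemmas fourier_coeff_0 = linear_0[OF bounded_linear.linear[OF bounded_linear_fourier_coeff]]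
lemmas fourier_coeff_sum = linear_sum[OF bounded_linear.linear[OF bounded_linear_fourier_coeff]]

lemma fourier_coeff_circle_power:
  "fourier_coeff n (circle_power m) = (if m = n then 1 else 0)"
proof -
  have "fourier_coeff n (circle_power m) = circle_mean (\<lambda>z. complex_of_circle z powi (m - n))"
    by (simp add: fourier_coeff_def power_int_add[symmetric])
  then show ?thesis by (simp add: circle_mean_power)
qed

lemma closed_fourier_coeff_zero: "closed {f. \<forall>n\<in>N. fourier_coeff n f = 0}"
proof -
  have "closed {f. fourier_coeff n f = 0}" for n
    using bounded_linear.continuous_on[OF bounded_linear_fourier_coeff continuous_on_id]
    by (intro closed_Collect_eq) auto
  then have "closed (\<Inter>n\<in>N. {f. fourier_coeff n f = 0})" by blast
  also have "(\<Inter>n\<in>N. {f. fourier_coeff n f = 0}) = {f. \<forall>n\<in>N. fourier_coeff n f = 0}" by auto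
  finally show ?thesis .
qed

lemma subspace_fourier_coeff_zero: "bcontfun_C.subspace {f. \<forall>n\<in>N. fourier_coeff n f = 0}"
  by (rule bcontfun_C.subspaceI) (auto simp: fourier_coeff_add fourier_coeff_0 fourier_coeff_scale)

text \<open>
  The functional \<open>g \<mapsto> mean of f g\<close> is continuous and vanishes on all powers, hence on the dense space of
  trigonometric polynomials, hence everywhere. Evaluating it at the conjugate of \<open>f\<close> shows that \<open>|f|\<^sup>2\<close>
  has mean zero.
\<close>

lemma fourier_coeff_unique:
  assumes f: "\<And>n. fourier_coeff n f = 0"
  shows "f = 0"
proof -
  define L where "L g = circle_mean (\<lambda>z. apply_bcontfun f z * apply_bcontfun g z)" for g :: circle_fun
  have L: "bounded_linear L"
    unfolding L_def[abs_def] by (rule mean_against_bounded_linear) simp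
  have Lscale: "L (scaleC_bcontfun c g) = c * L g" for c g
    unfolding L_def by (subst circle_mean_mult[symmetric]) (simp add: mult_ac)
  have "bcontfun_C.span (range circle_power) \<subseteq> {g. L g = 0}"
  proof (rule bcontfun_C.span_minimal)
    show "range circle_power \<subseteq> {g. L g = 0}"
    proof clarsimp
      fix n show "L (circle_power n) = 0"
        using f[of "- n"] by (simp add: L_def fourier_coeff_def mult.commute)
    qed
    show "bcontfun_C.subspace {g. L g = 0}"
      using linear_0[OF bounded_linear.linear[OF L]] linear_add[OF bounded_linear.linear[OF L]]
      by (intro bcontfun_C.subspaceI) (auto simp: Lscale)
  qed
  moreover have "closed {g. L g = 0}"
    using bounded_linear.continuous_on[OF L continuous_on_id]
    by (intro closed_Collect_eq) auto
  ultimately have "closure (bcontfun_C.span (range circle_power)) \<subseteq> {g. L g = 0}"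
    by (rule closure_minimal)
  then have L0: "L g = 0" for g by (auto simp: closure_trigonometric_polynomials)
  have cn: "(\<lambda>z. cnj (apply_bcontfun f z)) \<in> bcontfun"
    unfolding bcontfun_unit_circle_iff by (intro continuous_intros) auto
  let ?F = "\<lambda>\<theta>. (norm (apply_bcontfun f (circle_of_complex (cis \<theta>))))\<^sup>2"
  have cont: "continuous_on {0..2 * pi} ?F"
    by (intro continuous_on_circle_of_complex_cis[of "\<lambda>z. (norm (apply_bcontfun f z))\<^sup>2"] continuous_intros) auto
  have "L (Bcontfun (\<lambda>z. cnj (apply_bcontfun f z))) = integral {0..2 * pi} (\<lambda>\<theta>. complex_of_real (?F \<theta>)) / (2 * pi)"
    by (simp add: L_def Bcontfun_inverse[OF cn] circle_mean_def complex_norm_square[symmetric] of_real_power[symmetric] del: of_real_power)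
  with L0 have "integral {0..2 * pi} (\<lambda>\<theta>. complex_of_real (?F \<theta>)) = 0"
    by simp
  then have int0: "integral {0..2 * pi} ?F = 0"
    using integral_linear[OF integrable_continuous_real[OF cont] bounded_linear_of_real[where 'a = complex]]
    by (simp add: o_def)
  have F0: "?F \<theta> = 0" if "\<theta> \<in> {0..2 * pi}" for \<theta>
    using integral_eq_0_iff[OF cont] int0 that by simp
  show ?thesis
  proof (rule bcontfun_eqI)
    fix z
    obtain \<theta> where \<theta>: "0 \<le> \<theta>" "\<theta> < 2 * pi" "complex_of_circle z = cis \<theta>"
      using Arg2pi[of "complex_of_circle z"] by (auto simp: cis_conv_exp is_Arg_def)
    then have "z = circle_of_complex (cis \<theta>)" by (metis complex_of_circle_inverse)
    then show "apply_bcontfun f z = apply_bcontfun 0 z" using F0[of \<theta>] \<theta> by simp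
  qed
qed

lemma inj_circle_power: "inj circle_power"
proof (rule injI)
  fix m n assume "circle_power m = circle_power n"
  then have "fourier_coeff n (circle_power m) = fourier_coeff n (circle_power n)" by simp
  then show "m = n" by (simp add: fourier_coeff_circle_power split: if_splits)
qed

section \<open>Uniform limits of polynomials have no negative frequencies\<close>

lemma subspace_closure_Pol_circle: "bcontfun_C.subspace (closure Pol_circle)"
proof (rule bcontfun_C.subspace_closure, rule bcontfun_C.subspaceI)
  show "0 \<in> Pol_circle" by (auto simp: Pol_circle_def intro: exI[of _ 0])
next
  fix f g assume "f \<in> Pol_circle" "g \<in> Pol_circle"
  then obtain p q where "\<forall>z. apply_bcontfun f z = poly p (complex_of_circle z)"
    "\<forall>z. apply_bcontfun g z = poly q (complex_of_circle z)" by (auto simp: Pol_circle_def)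
  then show "f + g \<in> Pol_circle" by (auto simp: Pol_circle_def intro: exI[of _ "p + q"])
next
  fix c f assume "f \<in> Pol_circle"
  then obtain p where "\<forall>z. apply_bcontfun f z = poly p (complex_of_circle z)"
    by (auto simp: Pol_circle_def)
  then show "scaleC_bcontfun c f \<in> Pol_circle"
    by (auto simp: Pol_circle_def intro: exI[of _ "smult c p"])
qed

lemma circle_power_0_in_closure_Pol_circle: "circle_power 0 \<in> closure Pol_circle"
  by (rule subsetD[OF closure_subset]) (auto simp: Pol_circle_def intro: exI[of _ 1])

lemma fourier_coeff_closure_Pol_circle:
  assumes "f \<in> closure Pol_circle" "n < 0"
  shows "fourier_coeff n f = 0"
proof -
  have "Pol_circle \<subseteq> {f. \<forall>n\<in>{..<0}. fourier_coeff n f = 0}"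
  proof
    fix f assume "f \<in> Pol_circle"
    then obtain p where p: "\<And>z. apply_bcontfun f z = poly p (complex_of_circle z)"
      by (auto simp: Pol_circle_def)
    have f: "f = (\<Sum>i\<le>degree p. scaleC_bcontfun (coeff p i) (circle_power (int i)))"
    proof (rule bcontfun_eqI)
      fix z
      have "apply_bcontfun (\<Sum>i\<in>I. scaleC_bcontfun (coeff p i) (circle_power (int i))) z =
          (\<Sum>i\<in>I. coeff p i * complex_of_circle z ^ i)" for I
        by (induction I rule: infinite_finite_induct) auto
      then show "apply_bcontfun f z =
          apply_bcontfun (\<Sum>i\<le>degree p. scaleC_bcontfun (coeff p i) (circle_power (int i))) z"
        by (simp add: p poly_altdef)
    qed
    show "f \<in> {f. \<forall>n\<in>{..<0}. fourier_coeff n f = 0}"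
      by (auto simp: f fourier_coeff_sum fourier_coeff_scale fourier_coeff_circle_power intro!: sum.neutral)
  qed
  then have "closure Pol_circle \<subseteq> {f. \<forall>n\<in>{..<0}. fourier_coeff n f = 0}"
    by (rule closure_minimal) (rule closed_fourier_coeff_zero)
  with assms show ?thesis by auto
qed

text \<open>
  A decreasing chain of closed subspaces, each of which meets the uniform limits of polynomials only in \<open>0\<close>;
  by uniqueness of Fourier coefficients the chain shrinks to \<open>{0}\<close>.
\<close>

definition frequencies_below :: "nat \<Rightarrow> circle_fun set" where
  "frequencies_below m = {f. \<forall>n\<in>{- int m..}. fourier_coeff n f = 0}"

lemma frequencies_below_antimono: "m \<le> m' \<Longrightarrow> frequencies_below m' \<subseteq> frequencies_below m"
  by (auto simp: frequencies_below_def)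

lemma subspace_frequencies_below: "bcontfun_C.subspace (frequencies_below m)"
  unfolding frequencies_below_def by (rule subspace_fourier_coeff_zero)

lemma closed_frequencies_below: "closed (frequencies_below m)"
  unfolding frequencies_below_def by (rule closed_fourier_coeff_zero)

lemma frequencies_below_Int_closure_Pol_circle:
  assumes "f \<in> frequencies_below m" "f \<in> closure Pol_circle"
  shows "f = 0"
proof (rule fourier_coeff_unique)
  fix n
  show "fourier_coeff n f = 0"
    using assms fourier_coeff_closure_Pol_circle[of f n]
    by (cases "n < 0") (auto simp: frequencies_below_def)
qed

section \<open>A continuum of functions independent modulo limits of polynomials\<close>

text \<open>
  The series sums to \<open>(t/z)^(m+1) / (1 - t/z)\<close>; as a series it has visible Fourier coefficients.
\<close>

definition geometric_tail :: "nat \<Rightarrow> real \<Rightarrow> circle_fun" where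
  "geometric_tail m t = (\<Sum>j. t ^ (Suc m + j) *\<^sub>R circle_power (- int (Suc m + j)))"

lemma
  assumes t: "0 \<le> t" "t < 1"
  shows summable_geometric_tail:
      "summable (\<lambda>j. t ^ (Suc m + j) *\<^sub>R circle_power (- int (Suc m + j)))" (is "summable ?f")
    and norm_geometric_tail_le: "norm (geometric_tail m t) \<le> t ^ Suc m / (1 - t)"
proof -
  have le: "norm (?f j) \<le> t ^ Suc m * t ^ j" for j
    using mult_left_mono[OF norm_circle_power_le, of "t ^ (Suc m + j)" "- int (Suc m + j)"] t
    by (simp add: power_add mult_ac)
  have "(\<lambda>j. t ^ j) sums (1 / (1 - t))" using t by (intro geometric_sums) simp
  then have sums: "(\<lambda>j. t ^ Suc m * t ^ j) sums (t ^ Suc m * (1 / (1 - t)))" by (rule sums_mult)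
  have ns: "summable (\<lambda>j. norm (?f j))"
    by (rule summable_comparison_test'[OF sums_summable[OF sums], of 0]) (use le in simp)
  then show "summable ?f" by (rule summable_norm_cancel)
  have "norm (geometric_tail m t) \<le> (\<Sum>j. norm (?f j))"
    unfolding geometric_tail_def by (rule summable_norm[OF ns])
  also have "\<dots> \<le> (\<Sum>j. t ^ Suc m * t ^ j)"
    by (rule suminf_le[OF le ns sums_summable[OF sums]])
  also have "\<dots> = t ^ Suc m / (1 - t)" using sums_unique[OF sums] by simp
  finally show "norm (geometric_tail m t) \<le> t ^ Suc m / (1 - t)" .
qed

lemma fourier_coeff_geometric_tail:
  assumes t: "0 \<le> t" "t < 1"
  shows "fourier_coeff n (geometric_tail m t) = (if n < - int m then of_real (t ^ nat (- n)) else 0)"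
proof -
  interpret L: bounded_linear "fourier_coeff n" by (rule bounded_linear_fourier_coeff)
  let ?a = "\<lambda>j. t ^ (Suc m + j) *\<^sub>R (if - int (Suc m + j) = n then 1 else 0 :: complex)"
  have eq: "fourier_coeff n (geometric_tail m t) = (\<Sum>j. ?a j)"
    unfolding geometric_tail_def L.suminf[OF summable_geometric_tail[OF t]]
    by (simp only: L.scaleR fourier_coeff_circle_power)
  show ?thesis
  proof (cases "n < - int m")
    case True
    define k where "k = nat (- n) - Suc m"
    have k: "- int (Suc m + j) = n \<longleftrightarrow> j = k" for j using True by (auto simp: k_def)
    have "?a = (\<lambda>j. if j = k then of_real (t ^ (Suc m + j)) else 0)"
      unfolding k by (auto simp: scaleR_conv_of_real)
    then have "(\<Sum>j. ?a j) = of_real (t ^ (Suc m + k))"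
      using sums_unique[OF sums_single[of k "\<lambda>j. of_real (t ^ (Suc m + j)) :: complex"]] by simp
    also have "Suc m + k = nat (- n)" using True by (simp add: k_def)
    finally show ?thesis using True eq by simp
  next
    case False
    then have "?a j = 0" for j by auto
    with False eq show ?thesis by simp
  qed
qed

lemma geometric_tail_in_frequencies_below:
  "0 \<le> t \<Longrightarrow> t < 1 \<Longrightarrow> geometric_tail m t \<in> frequencies_below m"
  by (auto simp: frequencies_below_def fourier_coeff_geometric_tail)

text \<open>
  A Vandermonde argument: the hypothesis kills \<open>\<Sum>t\<in>F. c t * t^(m+1) * p t\<close> for every polynomial \<open>p\<close>,
  and \<open>p\<close> may be chosen to vanish on \<open>F\<close> except at \<open>s\<close>.
\<close>

lemma power_sums_zero_imp_zero:
  fixes c :: "real \<Rightarrow> complex"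
  assumes F: "finite F" "0 \<notin> F" and z: "\<And>k. k > m \<Longrightarrow> (\<Sum>t\<in>F. c t * of_real t ^ k) = 0" and s: "s \<in> F"
  shows "c s = 0"
proof -
  define p :: "complex poly" where "p = (\<Prod>r\<in>F - {s}. [:- of_real r, 1:])"
  have p: "poly p x = (\<Prod>r\<in>F - {s}. x - of_real r)" for x
    by (simp add: p_def poly_prod)
  have "(\<Sum>t\<in>F. c t * of_real t ^ Suc m * poly p (of_real t)) =
      (\<Sum>t\<in>F. \<Sum>i\<le>degree p. coeff p i * (c t * of_real t ^ (Suc m + i)))"
    unfolding poly_altdef by (simp add: sum_distrib_left mult_ac power_add)
  also have "\<dots> = (\<Sum>i\<le>degree p. coeff p i * (\<Sum>t\<in>F. c t * of_real t ^ (Suc m + i)))"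
    by (subst sum.swap) (simp add: sum_distrib_left)
  also have "\<dots> = 0"
  proof (intro sum.neutral ballI)
    fix i
    show "coeff p i * (\<Sum>t\<in>F. c t * of_real t ^ (Suc m + i)) = 0"
      using z[of "Suc m + i"] by simp
  qed
  finally have "(\<Sum>t\<in>F. c t * of_real t ^ Suc m * poly p (of_real t)) = 0" .
  moreover have "poly p (of_real t) = 0" if "t \<in> F - {s}" for t
    using that F(1) by (auto simp: p)
  ultimately have "c s * of_real s ^ Suc m * poly p (of_real s) = 0"
    by (simp add: sum.remove[OF F(1) s])
  moreover have "poly p (of_real s) \<noteq> 0" using F(1) by (auto simp: p)
  ultimately show ?thesis using s F(2) by auto
qed

text \<open>
  The coefficients at frequencies below \<open>- m\<close> already determine a combination of tails, and
  these coefficients are the power sums \<open>\<Sum>t. c t * t^k\<close> with \<open>k > m\<close>.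
\<close>

lemma independent_modulo_geometric_tail:
  "bcontfun_C.independent_modulo {f. \<forall>n\<in>{..<- int m}. fourier_coeff n f = 0} (geometric_tail m) {0<..<1}"
  unfolding bcontfun_C.independent_modulo_def
proof (intro allI impI ballI, elim conjE)
  fix F and c :: "real \<Rightarrow> complex" and s
  assume F: "finite F" "F \<subseteq> {0<..<1}" "s \<in> F"
    and sum: "(\<Sum>t\<in>F. scaleC_bcontfun (c t) (geometric_tail m t)) \<in>
      {f. \<forall>n\<in>{..<- int m}. fourier_coeff n f = 0}"
  show "c s = 0"
  proof (rule power_sums_zero_imp_zero[OF F(1) _ _ F(3), where m = m])
    show "0 \<notin> F" using F(2) by auto
    fix k assume k: "m < k"
    have "0 = fourier_coeff (- int k) (\<Sum>t\<in>F. scaleC_bcontfun (c t) (geometric_tail m t))"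
      using sum k by auto
    also have "\<dots> = (\<Sum>t\<in>F. c t * of_real t ^ k)"
      unfolding fourier_coeff_sum fourier_coeff_scale
    proof (rule sum.cong[OF refl])
      fix t assume "t \<in> F"
      then have "0 < t" "t < 1" using F(2) by auto
      then show "c t * fourier_coeff (- int k) (geometric_tail m t) = c t * of_real t ^ k"
        using k by (simp add: fourier_coeff_geometric_tail)
    qed
    finally show "(\<Sum>t\<in>F. c t * of_real t ^ k) = 0" by simp
  qed
qed

lemma geometric_tail_independent_modulo_closure_Pol_circle:
  "bcontfun_C.independent_modulo (closure Pol_circle) (geometric_tail 0) {0<..<1}"
  by (rule bcontfun_C.independent_modulo_mono[OF independent_modulo_geometric_tail])
    (auto simp: fourier_coeff_closure_Pol_circle)

section \<open>Adjoining finitely many vectors to a closed subspace\<close>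

lemma norm_scaleC_bcontfun: "norm (scaleC_bcontfun c f) = norm c * norm (f :: 'a :: topological_space \<Rightarrow>\<^sub>C complex)"
proof (cases "c = 0")
  case False
  have "norm f = norm (scaleC_bcontfun (inverse c) (scaleC_bcontfun c f))"
    using False by simp
  also have "\<dots> \<le> norm (inverse c) * norm (scaleC_bcontfun c f)" by (rule norm_scaleC_bcontfun_le)
  finally have "norm c * norm f \<le> norm (scaleC_bcontfun c f)"
    using False by (simp add: norm_inverse pos_divide_le_eq[symmetric] field_simps norm_divide)
  with norm_scaleC_bcontfun_le[of c f] show ?thesis by simp
qed simp

text \<open>
  If \<open>x\<close> has distance at least \<open>d > 0\<close> from \<open>V\<close>, then \<open>|c| d \<le> \<parallel>v + c x\<parallel>\<close> for all \<open>v\<close> in \<open>V\<close>. So the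
  \<open>x\<close>-coefficients of a convergent sequence in the span form a Cauchy sequence, and both components
  converge.
\<close>

lemma closed_span_insert:
  fixes V :: "('a::topological_space \<Rightarrow>\<^sub>C complex) set"
  assumes V: "bcontfun_C.subspace V" "closed V"
  shows "closed (bcontfun_C.span (insert x V))"
proof (cases "x \<in> V")
  case True
  then show ?thesis using V by (simp add: insert_absorb bcontfun_C.span_eq_iff[THEN iffD2])
next
  case False
  have span: "y \<in> bcontfun_C.span (insert x V) \<longleftrightarrow> (\<exists>c. y - scaleC_bcontfun c x \<in> V)" for y
    using V(1) by (simp add: bcontfun_C.span_breakdown_eq bcontfun_C.span_eq_iff[THEN iffD2])
  have "open (- V)" using V(2) by (simp add: open_Compl)
  then obtain d where d: "d > 0" "ball x d \<subseteq> - V" using False open_contains_ball by blast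
  have bound: "norm c * d \<le> norm y" if "y - scaleC_bcontfun c x \<in> V" for c y
  proof (cases "c = 0")
    case False
    let ?v = "scaleC_bcontfun (- inverse c) (y - scaleC_bcontfun c x)"
    have "?v \<in> V" by (rule bcontfun_C.subspace_scale[OF V(1) that])
    then have "d \<le> norm (x - ?v)" using d(2) by (force simp: dist_norm)
    also have "x - ?v = scaleC_bcontfun (inverse c) y"
      using False by (intro bcontfun_eqI) (simp add: algebra_simps)
    also have "norm \<dots> = norm y / norm c"
      by (simp add: norm_scaleC_bcontfun norm_inverse divide_inverse mult.commute)
    finally show ?thesis using False by (simp add: field_simps)
  qed simp
  show ?thesis
    unfolding closed_sequential_limits
  proof (intro allI impI, elim conjE)
    fix y l assume "\<forall>n. y n \<in> bcontfun_C.span (insert x V)" and l: "y \<longlonglongrightarrow> l"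
    then obtain c where c: "\<And>n. y n - scaleC_bcontfun (c n) x \<in> V" unfolding span by metis
    have "Cauchy c"
    proof (rule metric_CauchyI)
      fix e :: real assume "e > 0"
      then have "e * d > 0" using d(1) by simp
      then obtain M where M: "\<And>m n. m \<ge> M \<Longrightarrow> n \<ge> M \<Longrightarrow> dist (y m) (y n) < e * d"
        using metric_CauchyD[OF LIMSEQ_imp_Cauchy[OF l]] by metis
      have "dist (c m) (c n) < e" if "m \<ge> M" "n \<ge> M" for m n
      proof -
        have "(y m - y n) - scaleC_bcontfun (c m - c n) x \<in> V"
          using bcontfun_C.subspace_diff[OF V(1) c[of m] c[of n]]
          by (simp add: bcontfun_C.scale_left_diff_distrib algebra_simps)
        from bound[OF this] have "norm (c m - c n) * d < e * d"
          using M[OF that] by (simp add: dist_norm)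
        then show ?thesis using d(1) by (simp add: dist_norm)
      qed
      then show "\<exists>M. \<forall>m\<ge>M. \<forall>n\<ge>M. dist (c m) (c n) < e" by blast
    qed
    then obtain c0 where c0: "c \<longlonglongrightarrow> c0" using convergent_eq_Cauchy by metis
    have "(\<lambda>n. scaleC_bcontfun (c n) x) \<longlonglongrightarrow> scaleC_bcontfun c0 x"
    proof (rule LIM_zero_cancel, rule tendsto_norm_zero_cancel)
      have "(\<lambda>n. norm (c n - c0) * norm x) \<longlonglongrightarrow> 0 * norm x"
        by (intro tendsto_intros tendsto_norm_zero LIM_zero c0)
      then show "(\<lambda>n. norm (scaleC_bcontfun (c n) x - scaleC_bcontfun c0 x)) \<longlonglongrightarrow> 0"
        by (simp add: bcontfun_C.scale_left_diff_distrib[symmetric] norm_scaleC_bcontfun)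
    qed
    with l have "(\<lambda>n. y n - scaleC_bcontfun (c n) x) \<longlonglongrightarrow> l - scaleC_bcontfun c0 x"
      by (rule tendsto_diff)
    then have "l - scaleC_bcontfun c0 x \<in> V"
      by (rule closed_sequentially[OF V(2), rotated]) (rule c)
    then show "l \<in> bcontfun_C.span (insert x V)" unfolding span by blast
  qed
qed

lemma closed_span_Un_finite:
  fixes V :: "('a::topological_space \<Rightarrow>\<^sub>C complex) set"
  assumes V: "bcontfun_C.subspace V" "closed V" and B: "finite B"
  shows "closed (bcontfun_C.span (V \<union> B))"
  using B
proof induction
  case empty
  then show ?case using V by (simp add: bcontfun_C.span_eq_iff[THEN iffD2])
next
  case (insert b B)
  have "bcontfun_C.span (V \<union> insert b B) = bcontfun_C.span (insert b (bcontfun_C.span (V \<union> B)))"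
    unfolding bcontfun_C.span_insert bcontfun_C.span_span by (simp add: bcontfun_C.span_insert)
  with closed_span_insert[OF bcontfun_C.subspace_span insert.IH] show ?case by simp
qed

section \<open>Cardinalities\<close>

lemma card_of_open_interval_eq_continuum:
  fixes a b :: real
  assumes "a < b"
  shows "|{a<..<b}| =o |UNIV :: real set|"
  using open_interval_eqpoll_reals[of a b] assms by (auto simp: eqpoll_def intro: card_of_ordIsoI)

lemma card_of_countable_less_continuum:
  assumes "countable C"
  shows "|C| <o |UNIV :: real set|"
proof (rule ccontr)
  assume "\<not> |C| <o |UNIV :: real set|"
  then have "|UNIV :: real set| \<le>o |C|" by (simp add: not_ordLess_iff_ordLeq card_of_Well_order)
  then obtain f :: "real \<Rightarrow> _" where f: "inj f" "range f \<subseteq> C" unfolding card_of_ordLeq[symmetric] by auto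
  have "countable (UNIV :: real set)"
    using countable_subset[OF f(2) assms] f(1) by (rule countable_image_inj_on)
  then show False using uncountable_UNIV_real by simp
qed

lemma card_of_Un_ordLeq_infinite:
  assumes "infinite I" "|A| \<le>o |I|" "|B| \<le>o |I|"
  shows "|A \<union> B| \<le>o |I|"
  by (rule card_of_Un_ordLeq_infinite_Field[OF _ assms(2,3) card_of_Card_order])
    (simp add: Field_card_of assms(1))

lemma ex_inj_into_interval:
  fixes I :: "'i set" and a b :: real
  assumes "|I| \<le>o |UNIV :: real set|" "a < b"
  obtains f where "inj_on f I" "f ` I \<subseteq> {a<..<b}"
  using ordLeq_ordIso_trans[OF assms(1) ordIso_symmetric[OF card_of_open_interval_eq_continuum[OF assms(2)]]]
  unfolding card_of_ordLeq[symmetric] by blast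

text \<open>
  A function is determined by its countably many Fourier coefficients.
\<close>

lemma card_circle_fun_le: "|X :: circle_fun set| \<le>o |UNIV :: real set|"
proof -
  obtain \<phi> :: "real \<Rightarrow> nat set" where \<phi>: "inj \<phi>"
    using eqpoll_sym[OF nat_sets_eqpoll_reals] by (auto simp: eqpoll_def bij_betw_def)
  obtain \<psi> :: "nat set \<Rightarrow> real" where \<psi>: "inj \<psi>"
    using nat_sets_eqpoll_reals by (auto simp: eqpoll_def bij_betw_def)
  define code :: "circle_fun \<Rightarrow> ((int \<times> nat) + (int \<times> nat)) set" where
    "code f = {(n, k). k \<in> \<phi> (Re (fourier_coeff n f))} <+> {(n, k). k \<in> \<phi> (Im (fourier_coeff n f))}" for f
  have "inj code"
  proof (rule injI)
    fix f g assume eq: "code f = code g"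
    have 1: "k \<in> \<phi> (Re (fourier_coeff n f)) \<longleftrightarrow> k \<in> \<phi> (Re (fourier_coeff n g))" for n k
      using arg_cong[OF eq, of "\<lambda>S. Inl (n, k) \<in> S"] by (auto simp: code_def)
    have 2: "k \<in> \<phi> (Im (fourier_coeff n f)) \<longleftrightarrow> k \<in> \<phi> (Im (fourier_coeff n g))" for n k
      using arg_cong[OF eq, of "\<lambda>S. Inr (n, k) \<in> S"] by (auto simp: code_def)
    have "\<phi> (Re (fourier_coeff n f)) = \<phi> (Re (fourier_coeff n g))"
      "\<phi> (Im (fourier_coeff n f)) = \<phi> (Im (fourier_coeff n g))" for n
      using 1 2 by blast+
    then have "fourier_coeff n (f - g) = 0" for n
      using \<phi> by (simp add: fourier_coeff_diff complex_eq_iff inj_eq)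
    then show "f = g" using fourier_coeff_unique by force
  qed
  moreover have "inj (image to_nat :: ((int \<times> nat) + (int \<times> nat)) set \<Rightarrow> nat set)"
    by (rule injI) (simp add: inj_image_eq_iff)
  ultimately have "inj (\<psi> \<circ> image to_nat \<circ> code)"
    using \<psi> by (intro inj_compose)
  then show ?thesis
    by (intro card_of_ordLeqI) (auto intro: inj_on_subset)
qed

text \<open>
  The upper bound on the dimension is the cardinality of the whole space.
\<close>

lemma card_dim_eq_continuum:
  assumes W: "bcontfun_C.subspace W"
    and g: "bcontfun_C.independent_modulo {0} g {0<..<1::real}" "g ` {0<..<1} \<subseteq> W"
  shows "bcontfun_C.card_dim (W :: circle_fun set) =o |UNIV :: real set|"
proof -
  have Y: "bcontfun_C.subspace {0 :: circle_fun}" by (rule bcontfun_C.subspace_single_0)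
  have "bcontfun_C.independent (g ` {0<..<1})"
    using bcontfun_C.independent_modulo_union_basis[OF Y g(1), of "{}"]
    by (simp add: bcontfun_C.independent_empty)
  then obtain B where B: "g ` {0<..<1} \<subseteq> B" "B \<subseteq> W" "bcontfun_C.independent B" "W \<subseteq> bcontfun_C.span B"
    using bcontfun_C.maximal_independent_subset_extend[OF g(2)] by metis
  have "bcontfun_C.span B = W"
    using B(4) bcontfun_C.span_minimal[OF B(2) W] by auto
  then have dim: "bcontfun_C.card_dim W =o |B|"
    using bcontfun_C.card_dim_eq[OF B(3)] by (metis bcontfun_C.span_span)
  have "|UNIV :: real set| =o |g ` {0<..<1}|"
    using ordIso_transitive[OF bcontfun_C.card_of_image_independent_modulo[OF Y g(1)]
        card_of_open_interval_eq_continuum[OF zero_less_one]]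
    by (rule ordIso_symmetric)
  then have "|UNIV :: real set| \<le>o |B|"
    using card_of_mono1[OF B(1)] by (rule ordIso_ordLeq_trans)
  with card_circle_fun_le[of B] have "|B| =o |UNIV :: real set|"
    by (simp add: ordIso_iff_ordLeq)
  with dim show ?thesis by (rule ordIso_transitive)
qed

section \<open>Closed extensions of finite-dimensional spaces\<close>

lemma geometric_tail_independent: "bcontfun_C.independent_modulo {0} (geometric_tail m) {0<..<1}"
  by (rule bcontfun_C.independent_modulo_mono[OF independent_modulo_geometric_tail])
    (auto simp: fourier_coeff_0)

text \<open>
  Write \<open>V m\<close> for \<open>frequencies_below m\<close> and \<open>A\<close> for the uniform limits of polynomials. If \<open>span B\<close> meets \<open>A + V m\<close>
  only in \<open>0\<close>, then after adding a vector to \<open>B\<close> the intersection is at most a line. If it is a line,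
  generated by \<open>w = a + v\<close>, then \<open>v \<noteq> 0\<close>, and passing to an index \<open>M\<close> with \<open>v \<notin> V M\<close> destroys it:
  since \<open>A\<close> and \<open>V m\<close> meet only in \<open>0\<close>, \<open>w\<close> has no other decomposition.
\<close>

lemma frequencies_below_avoid_finite_dimensional:
  assumes "finite B" "bcontfun_C.span B \<inter> closure Pol_circle \<subseteq> {0}"
  shows "\<exists>m. \<forall>w\<in>bcontfun_C.span B. \<forall>a\<in>closure Pol_circle. w - a \<in> frequencies_below m \<longrightarrow> w = 0"
  using assms
proof (induction B)
  case empty
  then show ?case by simp
next
  case (insert b B)
  let ?A = "closure Pol_circle" and ?S = "bcontfun_C.span"
  note A = subspace_closure_Pol_circle and V = subspace_frequencies_below
  have "?S B \<subseteq> ?S (insert b B)" by (rule bcontfun_C.span_mono) auto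
  with insert obtain m where m: "\<And>w a. w \<in> ?S B \<Longrightarrow> a \<in> ?A \<Longrightarrow> w - a \<in> frequencies_below m \<Longrightarrow> w = 0"
    by blast
  show ?case
  proof (cases "\<exists>w\<in>?S (insert b B). \<exists>a\<in>?A. w - a \<in> frequencies_below m \<and> w \<noteq> 0")
    case False
    then show ?thesis by blast
  next
    case True
    then obtain w a where w: "w \<in> ?S (insert b B)" "w \<noteq> 0" and a: "a \<in> ?A" "w - a \<in> frequencies_below m"
      by blast
    obtain k where k: "w - scaleC_bcontfun k b \<in> ?S B"
      using w(1) by (auto simp: bcontfun_C.span_breakdown_eq)
    have "k \<noteq> 0" using m[of w a] k w(2) a by auto
    have "w - a \<noteq> 0" using w a(1) insert.prems by auto
    then obtain n where n: "fourier_coeff n (w - a) \<noteq> 0" using fourier_coeff_unique by blast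
    \<comment> \<open>large enough for the frequency \<open>n\<close>, at which \<open>w - a\<close> is visible, to be forbidden\<close>
    define M where "M = m + nat (- n)"
    have notM: "w - a \<notin> frequencies_below M"
      using n by (auto simp: frequencies_below_def M_def)
    have "w' = 0" if w': "w' \<in> ?S (insert b B)" and a': "a' \<in> ?A" "w' - a' \<in> frequencies_below M" for w' a'
    proof -
      obtain k' where k': "w' - scaleC_bcontfun k' b \<in> ?S B"
        using w' by (auto simp: bcontfun_C.span_breakdown_eq)
      \<comment> \<open>\<open>w' - r w\<close> has no component along \<open>b\<close>, so the induction hypothesis applies to it\<close>
      define r where "r = k' / k"
      let ?rw = "scaleC_bcontfun r w" and ?ra = "scaleC_bcontfun r a"
      have rk: "r * k = k'" using \<open>k \<noteq> 0\<close> by (simp add: r_def)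
      have va': "w' - a' \<in> frequencies_below m"
        using a'(2) frequencies_below_antimono[of m M] by (auto simp: M_def)
      have "(w' - scaleC_bcontfun k' b) - scaleC_bcontfun r (w - scaleC_bcontfun k b) \<in> ?S B"
        by (intro bcontfun_C.span_diff bcontfun_C.span_scale k k')
      then have 1: "w' - ?rw \<in> ?S B"
        by (simp add: bcontfun_C.scale_right_diff_distrib rk)
      have 2: "a' - ?ra \<in> ?A"
        by (intro bcontfun_C.subspace_diff[OF A] bcontfun_C.subspace_scale[OF A] a a')
      have "(w' - a') - scaleC_bcontfun r (w - a) \<in> frequencies_below m"
        by (intro bcontfun_C.subspace_diff[OF V] bcontfun_C.subspace_scale[OF V] a va')
      then have 3: "(w' - ?rw) - (a' - ?ra) \<in> frequencies_below m"
        by (simp add: bcontfun_C.scale_right_diff_distrib algebra_simps)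
      have w'eq: "w' = ?rw" using m[OF 1 2 3] by simp
      have "- (a' - ?ra) \<in> ?A" using 2 by (rule bcontfun_C.subspace_neg[OF A])
      then have "a' = ?ra"
        using frequencies_below_Int_closure_Pol_circle[of "- (a' - ?ra)" m] 3 w'eq by simp
      then have "scaleC_bcontfun r (w - a) \<in> frequencies_below M"
        using a'(2) w'eq by (simp add: bcontfun_C.scale_right_diff_distrib)
      from bcontfun_C.subspace_scale[OF V this, of "inverse r"] have "r = 0"
        using notM by (cases "r = 0") auto
      then show "w' = 0" using w'eq by simp
    qed
    then show ?thesis by blast
  qed
qed

text \<open>
  The extension is the sum of \<open>span B\<close> and a space \<open>frequencies_below m\<close> which meets the sum of
  \<open>span B\<close> and the uniform limits of polynomials only in \<open>0\<close>.
\<close>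

proposition ex_closed_extension_avoiding_closure_Pol_circle:
  assumes B: "finite B" "bcontfun_C.span B \<inter> closure Pol_circle \<subseteq> {0}"
  shows "\<exists>W. bcontfun_C.subspace W \<and> closed W \<and> bcontfun_C.card_dim W =o |UNIV :: real set| \<and>
    bcontfun_C.span B \<subseteq> W \<and> W \<inter> closure Pol_circle \<subseteq> {0}"
proof -
  obtain m where m: "\<And>w a. w \<in> bcontfun_C.span B \<Longrightarrow> a \<in> closure Pol_circle \<Longrightarrow>
      w - a \<in> frequencies_below m \<Longrightarrow> w = 0"
    using frequencies_below_avoid_finite_dimensional[OF B] by blast
  note V = subspace_frequencies_below[of m]
  let ?W = "bcontfun_C.span (frequencies_below m \<union> B)"
  have VW: "frequencies_below m \<subseteq> ?W"
    using bcontfun_C.span_superset[of "frequencies_below m \<union> B"] by blast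
  have "?W \<inter> closure Pol_circle \<subseteq> {0}"
  proof clarify
    fix y assume "y \<in> ?W" and yA: "y \<in> closure Pol_circle"
    then obtain v w where vw: "y = v + w" "v \<in> frequencies_below m" "w \<in> bcontfun_C.span B"
      using V by (auto simp: bcontfun_C.span_Un bcontfun_C.span_eq_iff[THEN iffD2])
    have "w - y \<in> frequencies_below m"
      using bcontfun_C.subspace_neg[OF V vw(2)] vw(1) by simp
    then have "w = 0" using m vw(3) yA by blast
    then show "y = 0"
      using frequencies_below_Int_closure_Pol_circle vw yA by simp
  qed
  moreover have "bcontfun_C.card_dim ?W =o |UNIV :: real set|"
    by (rule card_dim_eq_continuum[OF bcontfun_C.subspace_span geometric_tail_independent[of m]])
      (use VW in \<open>auto intro!: subsetD[OF VW] geometric_tail_in_frequencies_below\<close>)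
  moreover have "closed ?W"
    by (rule closed_span_Un_finite[OF V closed_frequencies_below B(1)])
  moreover have "bcontfun_C.span B \<subseteq> ?W" by (rule bcontfun_C.span_mono) simp
  ultimately show ?thesis using bcontfun_C.subspace_span by blast
qed

section \<open>Spaces whose closure meets the uniform limits of polynomials\<close>

lemma ex_span_avoiding_closure_Pol_circle:
  fixes I :: "'i set"
  assumes "|I| \<le>o |UNIV :: real set|"
  shows "\<exists>W. bcontfun_C.subspace W \<and> bcontfun_C.card_dim W =o |I| \<and> W \<inter> closure Pol_circle \<subseteq> {0}"
proof -
  obtain f :: "'i \<Rightarrow> real" where f: "inj_on f I" "f ` I \<subseteq> {0<..<1}"
    using ex_inj_into_interval[OF assms zero_less_one] by blast
  have g: "bcontfun_C.independent_modulo (closure Pol_circle) (geometric_tail 0 \<circ> f) I"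
    by (rule bcontfun_C.independent_modulo_reindex[OF geometric_tail_independent_modulo_closure_Pol_circle f])
  show ?thesis
    using bcontfun_C.card_dim_span_independent_modulo[OF subspace_closure_Pol_circle g]
      bcontfun_C.independent_modulo_span_Int[OF subspace_closure_Pol_circle g]
    by (intro exI[of _ "bcontfun_C.span ((geometric_tail 0 \<circ> f) ` I)"]) auto
qed

text \<open>
  The functions \<open>1 + (geometric tail with parameter t)\<close> are independent modulo the uniform limits of polynomials,
  yet they tend to the polynomial \<open>1\<close> as \<open>t \<rightarrow> 0\<close>. It suffices that the parameters in use accumulate at \<open>0\<close>.
\<close>

proposition ex_span_accumulating_at_closure_Pol_circle:
  fixes I :: "'i set"
  assumes I: "infinite I" "|I| \<le>o |UNIV :: real set|"
  shows "\<exists>W. bcontfun_C.subspace W \<and> bcontfun_C.card_dim W =o |I| \<and> W \<inter> closure Pol_circle \<subseteq> {0} \<and>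
    circle_power 0 \<in> closure W"
proof -
  obtain f :: "'i \<Rightarrow> real" where f: "inj_on f I" "f ` I \<subseteq> {0<..<1}"
    using ex_inj_into_interval[OF I(2) zero_less_one] by blast
  \<comment> \<open>the shift by 2 keeps \<open>s n\<close> below 1 and gives \<open>s n / (1 - s n) = 1 / (n + 1)\<close>\<close>
  define s where "s n = 1 / (real n + 2)" for n
  define T where "T = f ` I \<union> range s"
  have s: "s n \<in> {0<..<1}" for n by (auto simp: s_def)
  have "|T| \<le>o |I|"
    unfolding T_def
  proof (rule card_of_Un_ordLeq_infinite[OF I(1) card_of_image])
    show "|range s| \<le>o |I|"
      using ordLeq_transitive[OF card_of_image] I(1) unfolding infinite_iff_card_of_nat .
  qed
  moreover have "|I| \<le>o |T|" using f(1) by (intro card_of_ordLeqI[of f]) (auto simp: T_def)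
  ultimately have T: "|T| =o |I|" by (simp add: ordIso_iff_ordLeq)
  define g where "g t = circle_power 0 + geometric_tail 0 t" for t
  note A = subspace_closure_Pol_circle
  have "bcontfun_C.independent_modulo (closure Pol_circle) (geometric_tail 0) T"
    by (rule bcontfun_C.independent_modulo_mono[OF geometric_tail_independent_modulo_closure_Pol_circle])
      (use f(2) s in \<open>auto simp: T_def\<close>)
  then have g: "bcontfun_C.independent_modulo (closure Pol_circle) g T"
    by (rule bcontfun_C.independent_modulo_perturb[OF A, where e = "\<lambda>_. 1"])
      (simp add: g_def circle_power_0_in_closure_Pol_circle)
  let ?W = "bcontfun_C.span (g ` T)"
  have "(\<lambda>n. g (s n)) \<longlonglongrightarrow> circle_power 0"
  proof (rule LIM_zero_cancel, rule Lim_null_comparison)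
    show "\<forall>\<^sub>F n in sequentially. norm (g (s n) - circle_power 0) \<le> inverse (real (Suc n))"
    proof (rule always_eventually, rule allI)
      fix n
      have "norm (g (s n) - circle_power 0) \<le> s n / (1 - s n)"
        using norm_geometric_tail_le[of "s n" 0] s[of n] by (simp add: g_def)
      also have "\<dots> = inverse (real (Suc n))"
        by (simp add: s_def field_simps)
      finally show "norm (g (s n) - circle_power 0) \<le> inverse (real (Suc n))" .
    qed
  qed (rule LIMSEQ_inverse_real_of_nat)
  moreover have "g (s n) \<in> ?W" for n by (rule bcontfun_C.span_base) (auto simp: T_def)
  ultimately have "circle_power 0 \<in> closure ?W"
    unfolding closure_sequential by (intro exI[of _ "\<lambda>n. g (s n)"]) simp
  moreover have "bcontfun_C.card_dim ?W =o |I|"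
    using bcontfun_C.card_dim_span_independent_modulo[OF A g] T by (rule ordIso_transitive)
  moreover have "?W \<inter> closure Pol_circle \<subseteq> {0}"
    using bcontfun_C.independent_modulo_span_Int[OF A g] by auto
  ultimately show ?thesis using bcontfun_C.subspace_span by blast
qed

section \<open>Dense extensions of spaces of dimension below the continuum\<close>

text \<open>
  Fewer than continuum many vectors, namely \<open>B\<close> and all powers of \<open>z\<close>, are absorbed into a space \<open>Y\<close>
  containing the uniform limits of polynomials, modulo which continuum many geometric tails remain independent.
  Perturbing suitable tails by powers of \<open>z\<close> keeps this independence, so the new vectors avoid the
  uniform limits of polynomials even in combination with \<open>B\<close>; and since every power of \<open>z\<close> is approximated
  arbitrarily well, the span becomes dense.
\<close>

proposition ex_dense_extension_avoiding_closure_Pol_circle: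
  fixes I :: "'i set"
  assumes B: "bcontfun_C.independent B" "bcontfun_C.span B \<inter> closure Pol_circle \<subseteq> {0}"
    and card_B: "|B| <o |UNIV :: real set|" "|B| \<le>o |I|"
    and I: "infinite I" "|I| \<le>o |UNIV :: real set|"
  shows "\<exists>W. bcontfun_C.subspace W \<and> closure W = UNIV \<and> bcontfun_C.card_dim W =o |I| \<and>
    bcontfun_C.span B \<subseteq> W \<and> W \<inter> closure Pol_circle \<subseteq> {0}"
proof -
  \<comment> \<open>parameters below \<open>1/2\<close> keep the tails in the unit ball\<close>
  let ?J = "{0<..<1/2::real}"
  note continuum = card_of_open_interval_eq_continuum[of 0 "1/2::real"]
  have "bcontfun_C.independent_modulo (closure Pol_circle) (geometric_tail 0) ?J"
    by (rule bcontfun_C.independent_modulo_mono[OF geometric_tail_independent_modulo_closure_Pol_circle]) auto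
  moreover have "infinite (B \<union> range circle_power)"
    using inj_circle_power by (simp add: finite_image_iff infinite_UNIV_int)
  moreover have "|B \<union> range circle_power| <o |?J|"
  proof (rule ordLess_ordIso_trans[OF card_of_Un_ordLess_infinite])
    show "infinite (UNIV :: real set)" by (rule infinite_UNIV_char_0)
    show "|range circle_power| <o |UNIV :: real set|"
      by (rule card_of_countable_less_continuum) simp
    show "|UNIV :: real set| =o |?J|" using continuum by (simp add: ordIso_symmetric)
  qed (rule card_B)
  ultimately obtain Y J where Y: "bcontfun_C.subspace Y" "closure Pol_circle \<subseteq> Y" "B \<union> range circle_power \<subseteq> Y"
    and J: "J \<subseteq> ?J" "|?J| \<le>o |J|" "bcontfun_C.independent_modulo Y (geometric_tail 0) J"
    using bcontfun_C.large_independent_modulo[OF subspace_closure_Pol_circle] by blast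
  have "|I| \<le>o |?J|" using ordLeq_ordIso_trans[OF I(2) ordIso_symmetric] continuum by simp
  then have "|I| \<le>o |J|" using J(2) by (rule ordLeq_transitive)
  then obtain \<sigma> where \<sigma>: "inj_on \<sigma> I" "\<sigma> ` I \<subseteq> J" unfolding card_of_ordLeq[symmetric] by blast
  define g where "g = geometric_tail 0 \<circ> \<sigma>"
  have g: "bcontfun_C.independent_modulo Y g I"
    unfolding g_def by (rule bcontfun_C.independent_modulo_reindex[OF J(3) \<sigma>])
  have norm_g: "norm (g i) \<le> 1" if "i \<in> I" for i
  proof -
    have "\<sigma> i \<in> ?J" using \<sigma>(2) J(1) that by blast
    then have "0 < \<sigma> i" "\<sigma> i < 1/2" by auto
    then have "norm (geometric_tail 0 (\<sigma> i)) \<le> \<sigma> i / (1 - \<sigma> i)" "\<sigma> i / (1 - \<sigma> i) \<le> 1"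
      using norm_geometric_tail_le[of "\<sigma> i" 0] by simp_all
    from order_trans[OF this] show ?thesis by (simp add: g_def)
  qed
  obtain \<iota> :: "nat \<Rightarrow> 'i" where \<iota>: "inj \<iota>" "range \<iota> \<subseteq> I"
    using I(1) unfolding infinite_iff_countable_subset by blast
  \<comment> \<open>reserves one index for each power \<open>k\<close> and each precision \<open>n\<close>\<close>
  define \<kappa> :: "int \<times> nat \<Rightarrow> 'i" where "\<kappa> = \<iota> \<circ> to_nat"
  have \<kappa>: "inj \<kappa>" "range \<kappa> \<subseteq> I"
    using \<iota> by (auto simp: \<kappa>_def intro: inj_compose)
  \<comment> \<open>the tail at the index \<open>\<kappa> (k, n)\<close> is scaled down to norm at most \<open>1 / (n + 1)\<close>\<close>
  define e :: "'i \<Rightarrow> complex" where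
    "e i = (if i \<in> range \<kappa> then of_real (inverse (real (Suc (snd (inv \<kappa> i))))) else 1)" for i
  define x where
    "x i = (if i \<in> range \<kappa> then circle_power (fst (inv \<kappa> i)) else 0) + scaleC_bcontfun (e i) (g i)" for i
  have x: "bcontfun_C.independent_modulo Y x I"
  proof (rule bcontfun_C.independent_modulo_perturb[OF Y(1) g])
    fix i
    have "e i \<noteq> 0" unfolding e_def by (simp del: of_nat_Suc)
    moreover have "x i - scaleC_bcontfun (e i) (g i) \<in> Y"
      using Y(3) bcontfun_C.subspace_0[OF Y(1)] by (auto simp: x_def)
    ultimately show "e i \<noteq> 0 \<and> x i - scaleC_bcontfun (e i) (g i) \<in> Y" ..
  qed
  let ?W = "bcontfun_C.span (B \<union> x ` I)"
  have BY: "bcontfun_C.span B \<subseteq> Y" using Y(1,3) by (intro bcontfun_C.span_minimal) auto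
  have "?W \<inter> closure Pol_circle \<subseteq> {0}"
  proof clarify
    fix y assume "y \<in> ?W" and yA: "y \<in> closure Pol_circle"
    then obtain w u where wu: "y = w + u" "w \<in> bcontfun_C.span B" "u \<in> bcontfun_C.span (x ` I)"
      by (auto simp: bcontfun_C.span_Un)
    have "y - w \<in> Y" using yA Y(2) BY wu(2) by (intro bcontfun_C.subspace_diff[OF Y(1)]) auto
    then have "u = 0"
      using bcontfun_C.independent_modulo_span_Int[OF Y(1) x wu(3)] wu(1) by simp
    then show "y = 0" using B(2) wu yA by auto
  qed
  moreover have "bcontfun_C.card_dim ?W =o |I|"
  proof -
    have "bcontfun_C.independent (B \<union> x ` I)"
      using Y(3) by (intro bcontfun_C.independent_modulo_union_basis[OF Y(1) x B(1)]) auto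
    then have "bcontfun_C.card_dim ?W =o |B \<union> x ` I|"
      by (rule bcontfun_C.card_dim_eq) (simp add: bcontfun_C.span_span)
    moreover have "|B \<union> x ` I| \<le>o |I|"
      by (rule card_of_Un_ordLeq_infinite[OF I(1) card_B(2) card_of_image])
    moreover have "|I| \<le>o |B \<union> x ` I|"
      using bcontfun_C.independent_modulo_inj[OF Y(1) x] by (intro card_of_ordLeqI[of x]) auto
    ultimately show ?thesis by (meson ordIso_iff_ordLeq ordIso_transitive)
  qed
  moreover have "closure ?W = UNIV"
  proof -
    have "circle_power k \<in> closure ?W" for k
    proof -
      have "(\<lambda>n. x (\<kappa> (k, n))) \<longlonglongrightarrow> circle_power k"
      proof (rule LIM_zero_cancel, rule Lim_null_comparison)
        show "\<forall>\<^sub>F n in sequentially. norm (x (\<kappa> (k, n)) - circle_power k) \<le> inverse (real (Suc n))"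
        proof (rule always_eventually, rule allI)
          fix n
          have "x (\<kappa> (k, n)) - circle_power k =
              scaleC_bcontfun (of_real (inverse (real (Suc n)))) (g (\<kappa> (k, n)))"
            using \<kappa>(1) by (simp add: x_def e_def inv_f_f)
          then show "norm (x (\<kappa> (k, n)) - circle_power k) \<le> inverse (real (Suc n))"
            using norm_g[of "\<kappa> (k, n)"] \<kappa>(2)
            by (simp add: norm_scaleC_bcontfun norm_inverse mult_left_le range_subsetD del: of_nat_Suc)
        qed
      qed (rule LIMSEQ_inverse_real_of_nat)
      moreover have "x (\<kappa> (k, n)) \<in> ?W" for n
        using \<kappa>(2) by (intro bcontfun_C.span_base) auto
      ultimately show ?thesis
        unfolding closure_sequential by (intro exI[of _ "\<lambda>n. x (\<kappa> (k, n))"]) simp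
    qed
    then have "bcontfun_C.span (range circle_power) \<subseteq> closure ?W"
      by (intro bcontfun_C.span_minimal bcontfun_C.subspace_closure bcontfun_C.subspace_span) auto
    then have "closure (bcontfun_C.span (range circle_power)) \<subseteq> closure ?W"
      by (rule closure_minimal) simp
    then show ?thesis by (simp add: closure_trigonometric_polynomials top.extremum_unique)
  qed
  moreover have "bcontfun_C.span B \<subseteq> ?W" by (rule bcontfun_C.span_mono) simp
  ultimately show ?thesis using bcontfun_C.subspace_span by blast
qed

section \<open>Lineability of the complement of the uniform limits of polynomials\<close>

lemma subset_Compl_Un_zero_iff: "W \<subseteq> (UNIV - A) \<union> {0} \<longleftrightarrow> W \<inter> A \<subseteq> {0}"
  by auto

lemma span_singleton_Int_closure_Pol_circle:
  assumes "x \<notin> closure Pol_circle"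
  shows "bcontfun_C.independent {x}" "bcontfun_C.span {x} \<inter> closure Pol_circle \<subseteq> {0}"
proof -
  note A = subspace_closure_Pol_circle
  show "bcontfun_C.independent {x}"
    using assms bcontfun_C.subspace_0[OF A] by auto
  show "bcontfun_C.span {x} \<inter> closure Pol_circle \<subseteq> {0}"
  proof
    fix y assume "y \<in> bcontfun_C.span {x} \<inter> closure Pol_circle"
    then obtain c where c: "y = scaleC_bcontfun c x" "scaleC_bcontfun c x \<in> closure Pol_circle"
      by (auto simp: bcontfun_C.span_singleton)
    from bcontfun_C.subspace_scale[OF A c(2), of "inverse c"] assms
    show "y \<in> {0}" by (cases "c = 0") (auto simp: c(1))
  qed
qed

theorem corollary3p22:
  shows "(\<forall>\<alpha>::'a rel. Card_order \<alpha> \<and> \<alpha> \<le>o |UNIV :: real set| \<longrightarrow>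
            (bcontfun_C.spaceable \<alpha> |UNIV :: real set| (UNIV - closure Pol_circle) \<longleftrightarrow> \<alpha> <o natLeq)) \<and>
         bcontfun_C.pointwise_spaceable |UNIV :: real set| (UNIV - closure Pol_circle) \<and>
         (\<forall>(\<alpha>::'b rel) (\<beta>::'c rel). Card_order \<alpha> \<and> Card_order \<beta> \<and> \<alpha> <o |UNIV :: real set| \<and>
            \<alpha> \<le>o \<beta> \<and> natLeq \<le>o \<beta> \<and> \<beta> \<le>o |UNIV :: real set| \<longrightarrow>
            bcontfun_C.dense_lineable \<alpha> \<beta> (UNIV - closure Pol_circle)) \<and>
         bcontfun_C.pointwise_maximal_dense_lineable (UNIV - closure Pol_circle)"
proof (intro conjI allI impI; (elim conjE)?)
  fix \<alpha> :: "'a rel"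
  assume \<alpha>: "Card_order \<alpha>" "\<alpha> \<le>o |UNIV :: real set|"
  have F: "|Field \<alpha>| =o \<alpha>" using \<alpha>(1) by (rule card_of_Field_ordIso)
  have F_le: "|Field \<alpha>| \<le>o |UNIV :: real set|" using F \<alpha>(2) by (rule ordIso_ordLeq_trans)
  show "bcontfun_C.spaceable \<alpha> |UNIV :: real set| (UNIV - closure Pol_circle) \<longleftrightarrow> \<alpha> <o natLeq"
  proof
    assume sp: "bcontfun_C.spaceable \<alpha> |UNIV :: real set| (UNIV - closure Pol_circle)"
    show "\<alpha> <o natLeq"
    proof (rule ccontr)
      assume "\<not> \<alpha> <o natLeq"
      then have "infinite (Field \<alpha>)"
        using F by (meson finite_iff_ordLess_natLeq ordIso_ordLess_trans ordIso_symmetric)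
      from ex_span_accumulating_at_closure_Pol_circle[OF this F_le] obtain W where
        W: "bcontfun_C.subspace W" "bcontfun_C.card_dim W =o \<alpha>" "W \<inter> closure Pol_circle \<subseteq> {0}"
          "circle_power 0 \<in> closure W"
        using F ordIso_transitive by blast
      obtain W' where W': "closed W'" "W \<subseteq> W'" "W' \<inter> closure Pol_circle \<subseteq> {0}"
      proof -
        have "\<exists>W'. bcontfun_C.subspace W' \<and> closed W' \<and> bcontfun_C.card_dim W' =o |UNIV :: real set| \<and>
            W \<subseteq> W' \<and> W' \<inter> closure Pol_circle \<subseteq> {0}"
          using sp[unfolded bcontfun_C.spaceable_def subset_Compl_Un_zero_iff] W(1-3) by simp
        then show thesis using that by (elim exE conjE)
      qed
      have "circle_power 0 \<in> W'" using closure_minimal[OF W'(2,1)] W(4) by blast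
      then have "circle_power 0 = 0" using W'(3) circle_power_0_in_closure_Pol_circle by blast
      then show False using fourier_coeff_circle_power[of 0 0] by (simp add: fourier_coeff_0)
    qed
  next
    assume fin: "\<alpha> <o natLeq"
    show "bcontfun_C.spaceable \<alpha> |UNIV :: real set| (UNIV - closure Pol_circle)"
      unfolding bcontfun_C.spaceable_def bcontfun_C.lineable_def subset_Compl_Un_zero_iff
    proof (intro conjI allI impI; (elim conjE)?)
      show "\<exists>W. bcontfun_C.subspace W \<and> bcontfun_C.card_dim W =o \<alpha> \<and> W \<inter> closure Pol_circle \<subseteq> {0}"
        using ex_span_avoiding_closure_Pol_circle[OF F_le] F ordIso_transitive by blast
      fix W assume W: "bcontfun_C.subspace W" "bcontfun_C.card_dim W =o \<alpha>" "W \<inter> closure Pol_circle \<subseteq> {0}"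
      obtain B where B: "bcontfun_C.span B = W" "bcontfun_C.card_dim W =o |B|"
        using bcontfun_C.card_dim_basis[OF W(1)] by blast
      have "|B| =o \<alpha>" using B(2) W(2) by (meson ordIso_symmetric ordIso_transitive)
      then have "finite B" using fin by (meson finite_iff_ordLess_natLeq ordIso_ordLess_trans)
      from ex_closed_extension_avoiding_closure_Pol_circle[OF this] B(1) W(3)
      show "\<exists>W'. bcontfun_C.subspace W' \<and> closed W' \<and> bcontfun_C.card_dim W' =o |UNIV :: real set| \<and>
          W \<subseteq> W' \<and> W' \<inter> closure Pol_circle \<subseteq> {0}" by blast
    qed
  qed
next
  show "bcontfun_C.pointwise_spaceable |UNIV :: real set| (UNIV - closure Pol_circle)"
    unfolding bcontfun_C.pointwise_spaceable_def subset_Compl_Un_zero_iff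
  proof
    fix x :: circle_fun assume "x \<in> UNIV - closure Pol_circle"
    then have "bcontfun_C.span {x} \<inter> closure Pol_circle \<subseteq> {0}"
      by (intro span_singleton_Int_closure_Pol_circle) auto
    from ex_closed_extension_avoiding_closure_Pol_circle[OF _ this]
    show "\<exists>W. bcontfun_C.subspace W \<and> closed W \<and> bcontfun_C.card_dim W =o |UNIV :: real set| \<and>
        x \<in> W \<and> W \<inter> closure Pol_circle \<subseteq> {0}"
      using bcontfun_C.span_base[of x "{x}"] by blast
  qed
next
  fix \<alpha> :: "'b rel" and \<beta> :: "'c rel"
  assume \<alpha>: "Card_order \<alpha>" "\<alpha> <o |UNIV :: real set|" "\<alpha> \<le>o \<beta>"
    and \<beta>: "Card_order \<beta>" "natLeq \<le>o \<beta>" "\<beta> \<le>o |UNIV :: real set|"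
  have F\<alpha>: "|Field \<alpha>| =o \<alpha>" using \<alpha>(1) by (rule card_of_Field_ordIso)
  have F\<alpha>_le: "|Field \<alpha>| \<le>o |UNIV :: real set|"
    using F\<alpha> \<alpha>(2) by (meson ordIso_ordLeq_trans ordLess_imp_ordLeq)
  have F\<beta>: "|Field \<beta>| =o \<beta>" using \<beta>(1) by (rule card_of_Field_ordIso)
  have F\<beta>_le: "|Field \<beta>| \<le>o |UNIV :: real set|" using F\<beta> \<beta>(3) by (rule ordIso_ordLeq_trans)
  have inf: "infinite (Field \<beta>)"
    using F\<beta> \<beta>(2) by (meson infinite_iff_natLeq_ordLeq ordIso_symmetric ordLeq_ordIso_trans)
  show "bcontfun_C.dense_lineable \<alpha> \<beta> (UNIV - closure Pol_circle)"
    unfolding bcontfun_C.dense_lineable_def bcontfun_C.lineable_def subset_Compl_Un_zero_iff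
  proof (intro conjI allI impI; (elim conjE)?)
    show "\<exists>W. bcontfun_C.subspace W \<and> bcontfun_C.card_dim W =o \<alpha> \<and> W \<inter> closure Pol_circle \<subseteq> {0}"
      using ex_span_avoiding_closure_Pol_circle[OF F\<alpha>_le] F\<alpha> ordIso_transitive by blast
    fix W assume W: "bcontfun_C.subspace W" "bcontfun_C.card_dim W =o \<alpha>" "W \<inter> closure Pol_circle \<subseteq> {0}"
    obtain B where B: "bcontfun_C.independent B" "bcontfun_C.span B = W" "bcontfun_C.card_dim W =o |B|"
      using bcontfun_C.card_dim_basis[OF W(1)] by blast
    have card_B: "|B| =o \<alpha>" using B(3) W(2) by (meson ordIso_symmetric ordIso_transitive)
    have "|B| <o |UNIV :: real set|" using card_B \<alpha>(2) by (rule ordIso_ordLess_trans)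
    moreover have "|B| \<le>o |Field \<beta>|"
      using card_B \<alpha>(3) F\<beta> by (meson ordIso_ordLeq_trans ordIso_symmetric ordLeq_ordIso_trans)
    ultimately obtain W' where W': "bcontfun_C.subspace W'" "closure W' = UNIV"
        "bcontfun_C.card_dim W' =o |Field \<beta>|" "W \<subseteq> W'" "W' \<inter> closure Pol_circle \<subseteq> {0}"
      using ex_dense_extension_avoiding_closure_Pol_circle[OF B(1) _ _ _ inf F\<beta>_le] B(2) W(3) by blast
    then show "\<exists>W'. bcontfun_C.subspace W' \<and> closure W' = UNIV \<and> bcontfun_C.card_dim W' =o \<beta> \<and>
        W \<subseteq> W' \<and> W' \<inter> closure Pol_circle \<subseteq> {0}"
      using ordIso_transitive[OF W'(3) F\<beta>] by (intro exI[of _ W'] conjI)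
  qed
next
  have dim: "bcontfun_C.card_dim (UNIV :: circle_fun set) =o |UNIV :: real set|"
    by (rule card_dim_eq_continuum[OF bcontfun_C.subspace_UNIV geometric_tail_independent[of 0]]) simp
  show "bcontfun_C.pointwise_maximal_dense_lineable (UNIV - closure Pol_circle)"
    unfolding bcontfun_C.pointwise_maximal_dense_lineable_def bcontfun_C.pointwise_dense_lineable_def
      subset_Compl_Un_zero_iff
  proof
    fix x :: circle_fun assume "x \<in> UNIV - closure Pol_circle"
    then have x: "bcontfun_C.independent {x}" "bcontfun_C.span {x} \<inter> closure Pol_circle \<subseteq> {0}"
      using span_singleton_Int_closure_Pol_circle by auto
    have less: "|{x}| <o |UNIV :: real set|" by (rule card_of_countable_less_continuum) simp
    obtain W where W: "bcontfun_C.subspace W" "closure W = UNIV" "bcontfun_C.card_dim W =o |UNIV :: real set|"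
        "bcontfun_C.span {x} \<subseteq> W" "W \<inter> closure Pol_circle \<subseteq> {0}"
      using ex_dense_extension_avoiding_closure_Pol_circle[OF x less ordLess_imp_ordLeq[OF less]
          infinite_UNIV_char_0 ordLeq_refl[OF card_of_Card_order]] by (elim exE conjE)
    then show "\<exists>W. bcontfun_C.subspace W \<and> closure W = UNIV \<and> bcontfun_C.card_dim W =o bcontfun_C.card_dim (UNIV :: circle_fun set) \<and>
        x \<in> W \<and> W \<inter> closure Pol_circle \<subseteq> {0}"
      using bcontfun_C.span_base[of x "{x}"] ordIso_transitive[OF W(3) ordIso_symmetric[OF dim]]
      by (intro exI[of _ W] conjI) auto
  qed
qed

end
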